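(* Let $T$ be a Gibbs-Markov map on the Lebesgue probability space $(X,\mu)$ with Markov partition $\mathcal{A}$. For $x\in X$ let $U_n=A_n(x)$ be the $n$-cylinder containing $x$. Then $$\rho(x)=\lim_{n\to\infty}\frac{\rho_{U_n}}{\mu(U_n)}=\begin{cases}1&\text{if }x\text{ is not periodic}\\1-g_m(x)&\text{if }x\text{ is periodic with minimal period }m\text{, provided }g_m(x)<\frac12.\end{cases}$$
   Context: A map $T$ on a Lebesgue probability space $(X,\mu)$ is Markov if there is a countable measurable partition $\mathcal{A}$ of $X$ with $\mu(A)>0$ for all $A\in\mathcal{A}$ such that for every $A\in\mathcal{A}$ the restriction $T|_A$ is injective and $T(A)$ is a union of elements of $\mathcal{A}$. Put $\mathcal{A}^n=\bigvee_{j=0}^{n-1}T^{-j}\mathcal{A}$; its elements are the $n$-cylinders and $A_n(x)\in\mathcal{A}^n$ is the one containing $x$. It is assumed that $\mathcal{A}$ is (one-sided) generating, i.e. $\bigcap_nA_n(x)=\{x\}$. Fix $\lambda\in(0,1)$ and let $d_\lambda(x,y)=\lambda^{s(x,y)}$, where $s(x,y)$ is the largest positive integer $n$ such that $x,y$ lie in the same $n$-cylinder. Let $g=JT^{-1}=\frac{d\mu}{d\mu\circ T}$ and $g_k=g\cdot g\circ T\cdots g\circ T^{k-1}$. $T$ is Gibbs-Markov if it preserves $\mu$ and satisfies: (i) big image property: there exists $C>0$ such that $\mu(T(A))>C$ for all $A\in\mathcal{A}$; (ii) distortion: $\log g|_A$ is Lipschitz with respect to $d_\lambda$ for all $A\in\mathcal{A}$,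 uniformly in $A$, so that there is a constant $D>1$ with $\left|\frac{g_n(x)}{g_n(y)}-1\right|\le D\,d_\lambda(T^nx,T^ny)$ for all $x,y$ in the same $n$-cylinder, and $D^{-1}\le\frac{\mu(A_n(x))}{g_n(x)}\le D$. For $U\subset X$, $\tau_U(x)=\inf\{j\ge1:T^jx\in U\}$ and $\rho_U=\lim_{t\to\infty}\frac1t|\log\mu(\tau_U>t)|$ is the escape rate to $U$ (whenever the limit exists).
   Formalization: The formal theorem additionally assumes that T is ergodic; without this the claim fails (for example two disjoint copies of the doubling map, where every escape rate to a cylinder is 0). *)

theory Defs
  imports "HOL-Probability.Probability"
begin

section \<open>Lebesgue probability spaces\<close>

text \<open>
  The model space: Lebesgue measure on the interval \<open>(0, a)\<close> together with atoms of mass \<open>c n\<close>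
  at the points \<open>-n\<close>, completed. Zero masses, and \<open>a = 0\<close>, are allowed.
\<close>

definition interval_with_atoms :: "real \<Rightarrow> (nat \<Rightarrow> real) \<Rightarrow> real measure" where
  "interval_with_atoms a c = completion (measure_of UNIV (sets borel)
     (\<lambda>B. emeasure lborel (B \<inter> {0<..<a}) + (\<Sum>n. ennreal (c n) * indicator B (- real n))))"

definition isomorphic_mod_0 :: "'a measure \<Rightarrow> 'b measure \<Rightarrow> bool" where
  "isomorphic_mod_0 M N \<longleftrightarrow>
     (\<exists>M0 \<in> null_sets M. \<exists>N0 \<in> null_sets N. \<exists>f.
        bij_betw f (space M - M0) (space N - N0) \<and>
        (\<forall>E \<subseteq> space M - M0.
           (E \<in> sets M \<longleftrightarrow> f ` E \<in> sets N) \<and>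
           (E \<in> sets M \<longrightarrow> emeasure N (f ` E) = emeasure M E)))"

definition lebesgue_probability_space :: "'a measure \<Rightarrow> bool" where
  "lebesgue_probability_space M \<longleftrightarrow>
     prob_space M \<and> complete_measure M \<and>
     (\<exists>a c. 0 \<le> a \<and> (\<forall>n. 0 \<le> c n) \<and> isomorphic_mod_0 M (interval_with_atoms a c))"


section \<open>Cylinders and Markov maps\<close>

text \<open>The nonempty elements of the join of the partitions \<open>T\<^sup>-\<^sup>jP\<close>, \<open>j < n\<close>.\<close>

primrec cylinders :: "'a measure \<Rightarrow> ('a \<Rightarrow> 'a) \<Rightarrow> 'a set set \<Rightarrow> nat \<Rightarrow> 'a set set" where
  "cylinders M T P 0 = {space M}"
| "cylinders M T P (Suc n) = {C \<inter> (T ^^ n) -` A | C A. C \<in> cylinders M T P n \<and> A \<in> P} - {{}}"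

definition cylinder_of :: "'a measure \<Rightarrow> ('a \<Rightarrow> 'a) \<Rightarrow> 'a set set \<Rightarrow> nat \<Rightarrow> 'a \<Rightarrow> 'a set" where
  "cylinder_of M T P n x = (THE C. C \<in> cylinders M T P n \<and> x \<in> C)"

definition generating :: "'a measure \<Rightarrow> ('a \<Rightarrow> 'a) \<Rightarrow> 'a set set \<Rightarrow> bool" where
  "generating M T P \<longleftrightarrow> (\<forall>x \<in> space M. (\<Inter>n. cylinder_of M T P n x) = {x})"

definition markov_map :: "'a measure \<Rightarrow> ('a \<Rightarrow> 'a) \<Rightarrow> 'a set set \<Rightarrow> bool" where
  "markov_map M T P \<longleftrightarrow>
     T \<in> measurable M M \<and>
     countable P \<and> partition_on (space M) P \<and> P \<subseteq> sets M \<and>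
     (\<forall>A \<in> P. measure M A > 0) \<and>
     (\<forall>A \<in> P. inj_on T A \<and> (\<exists>Q \<subseteq> P. T ` A = \<Union>Q)) \<and>
     generating M T P"

text \<open>
  The separation time is \<open>0\<close> for points in different elements of \<open>P\<close> and infinite for points
  that no cylinder separates, so that \<open>cylinder_dist lam M T P x x = 0\<close>.
\<close>

definition separation_time ::
  "'a measure \<Rightarrow> ('a \<Rightarrow> 'a) \<Rightarrow> 'a set set \<Rightarrow> 'a \<Rightarrow> 'a \<Rightarrow> enat" where
  "separation_time M T P x y =
     Sup (enat ` {n. 1 \<le> n \<and> (\<exists>C \<in> cylinders M T P n. x \<in> C \<and> y \<in> C)})"

definition cylinder_dist ::
  "real \<Rightarrow> 'a measure \<Rightarrow> ('a \<Rightarrow> 'a) \<Rightarrow> 'a set set \<Rightarrow> 'a \<Rightarrow> 'a \<Rightarrow> real" where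
  "cylinder_dist lam M T P x y =
     (case separation_time M T P x y of enat n \<Rightarrow> lam ^ n | \<infinity> \<Rightarrow> 0)"


section \<open>The Jacobian\<close>

text \<open>
  The measure usually written \<open>\<mu> \<circ> T\<close>: on each element of \<open>P\<close>, where \<open>T\<close> is injective, it assigns
  to a set the measure of its image, and it is extended additively to the whole space.
\<close>

definition forward_measure :: "'a measure \<Rightarrow> ('a \<Rightarrow> 'a) \<Rightarrow> 'a set set \<Rightarrow> 'a measure" where
  "forward_measure M T P = measure_of (space M) (sets M)
     (\<lambda>E. \<integral>\<^sup>+A. emeasure M (T ` (E \<inter> A)) \<partial>count_space P)"

text \<open>
  \<open>g\<close> is a (pointwise defined) version of the Radon-Nikodym derivative of \<open>\<mu>\<close> with respect to
  \<open>\<mu> \<circ> T\<close>. Forward measurability is what makes \<open>\<mu> \<circ> T\<close> a measure; positivity makes \<open>ln g\<close>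
  meaningful.
\<close>

definition inverse_jacobian :: "'a measure \<Rightarrow> ('a \<Rightarrow> 'a) \<Rightarrow> 'a set set \<Rightarrow> ('a \<Rightarrow> real) \<Rightarrow> bool" where
  "inverse_jacobian M T P g \<longleftrightarrow>
     (\<forall>A \<in> P. \<forall>E \<in> sets M. E \<subseteq> A \<longrightarrow> T ` E \<in> sets M) \<and>
     g \<in> borel_measurable M \<and> (\<forall>x \<in> space M. 0 < g x) \<and>
     density (forward_measure M T P) (\<lambda>x. ennreal (g x)) = M"

definition cocycle_prod :: "('a \<Rightarrow> 'a) \<Rightarrow> ('a \<Rightarrow> real) \<Rightarrow> nat \<Rightarrow> 'a \<Rightarrow> real" where
  "cocycle_prod T g k x = (\<Prod>j<k. g ((T ^^ j) x))"


section \<open>Gibbs-Markov maps\<close>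

definition measure_preserving_map :: "'a measure \<Rightarrow> ('a \<Rightarrow> 'a) \<Rightarrow> bool" where
  "measure_preserving_map M T \<longleftrightarrow> T \<in> measurable M M \<and> distr M M T = M"

definition ergodic :: "'a measure \<Rightarrow> ('a \<Rightarrow> 'a) \<Rightarrow> bool" where
  "ergodic M T \<longleftrightarrow>
     (\<forall>E \<in> sets M. T -` E \<inter> space M = E \<longrightarrow> measure M E = 0 \<or> measure M E = 1)"

definition big_image :: "'a measure \<Rightarrow> ('a \<Rightarrow> 'a) \<Rightarrow> 'a set set \<Rightarrow> bool" where
  "big_image M T P \<longleftrightarrow> (\<exists>C > 0. \<forall>A \<in> P. measure M (T ` A) > C)"

definition bounded_distortion ::
  "real \<Rightarrow> 'a measure \<Rightarrow> ('a \<Rightarrow> 'a) \<Rightarrow> 'a set set \<Rightarrow> ('a \<Rightarrow> real) \<Rightarrow> bool" where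
  "bounded_distortion lam M T P g \<longleftrightarrow>
     (\<exists>L. \<forall>A \<in> P. \<forall>x \<in> A. \<forall>y \<in> A. \<bar>ln (g x) - ln (g y)\<bar> \<le> L * cylinder_dist lam M T P x y) \<and>
     (\<exists>D > 1.
        (\<forall>n \<ge> 1. \<forall>C \<in> cylinders M T P n. \<forall>x \<in> C. \<forall>y \<in> C.
           \<bar>cocycle_prod T g n x / cocycle_prod T g n y - 1\<bar>
             \<le> D * cylinder_dist lam M T P ((T ^^ n) x) ((T ^^ n) y)) \<and>
        (\<forall>n \<ge> 1. \<forall>x \<in> space M.
           1 / D \<le> measure M (cylinder_of M T P n x) / cocycle_prod T g n x \<and>
           measure M (cylinder_of M T P n x) / cocycle_prod T g n x \<le> D))"

definition gibbs_markov ::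
  "real \<Rightarrow> 'a measure \<Rightarrow> ('a \<Rightarrow> 'a) \<Rightarrow> 'a set set \<Rightarrow> ('a \<Rightarrow> real) \<Rightarrow> bool" where
  "gibbs_markov lam M T P g \<longleftrightarrow>
     markov_map M T P \<and> measure_preserving_map M T \<and> inverse_jacobian M T P g \<and>
     big_image M T P \<and> bounded_distortion lam M T P g"


section \<open>Escape rates\<close>

definition hitting_time :: "('a \<Rightarrow> 'a) \<Rightarrow> 'a set \<Rightarrow> 'a \<Rightarrow> enat" where
  "hitting_time T U x = Inf (enat ` {j. 1 \<le> j \<and> (T ^^ j) x \<in> U})"

text \<open>\<open>\<bar>ln p\<bar>\<close> with the convention \<open>\<bar>ln 0\<bar> = \<infinity>\<close>.\<close>

definition abs_ln :: "real \<Rightarrow> ereal" where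
  "abs_ln p = (if p = 0 then \<infinity> else ereal \<bar>ln p\<bar>)"

definition escape_seq :: "'a measure \<Rightarrow> ('a \<Rightarrow> 'a) \<Rightarrow> 'a set \<Rightarrow> nat \<Rightarrow> ereal" where
  "escape_seq M T U t =
     ereal (1 / real t) * abs_ln (measure M {x \<in> space M. hitting_time T U x > enat t})"

definition has_escape_rate :: "'a measure \<Rightarrow> ('a \<Rightarrow> 'a) \<Rightarrow> 'a set \<Rightarrow> bool" where
  "has_escape_rate M T U \<longleftrightarrow> convergent (escape_seq M T U)"

definition escape_rate :: "'a measure \<Rightarrow> ('a \<Rightarrow> 'a) \<Rightarrow> 'a set \<Rightarrow> ereal" where
  "escape_rate M T U = lim (escape_seq M T U)"

text \<open>
  The escape rates to \<open>U n\<close> exist for all large \<open>n\<close>, and their ratios to the measures of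
  \<open>U n\<close> converge to \<open>r\<close>.
\<close>

definition has_local_escape_rate ::
  "'a measure \<Rightarrow> ('a \<Rightarrow> 'a) \<Rightarrow> (nat \<Rightarrow> 'a set) \<Rightarrow> real \<Rightarrow> bool" where
  "has_local_escape_rate M T U r \<longleftrightarrow>
     (\<forall>\<^sub>F n in sequentially. has_escape_rate M T (U n)) \<and>
     (\<lambda>n. escape_rate M T (U n) / ereal (measure M (U n))) \<longlonglongrightarrow> ereal r"

definition periodic_point :: "('a \<Rightarrow> 'a) \<Rightarrow> 'a \<Rightarrow> bool" where
  "periodic_point T x \<longleftrightarrow> (\<exists>m \<ge> 1. (T ^^ m) x = x)"

definition minimal_period :: "('a \<Rightarrow> 'a) \<Rightarrow> 'a \<Rightarrow> nat" where
  "minimal_period T x = (LEAST m. 1 \<le> m \<and> (T ^^ m) x = x)"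

end

theory Submission
  imports Defs
begin

text \<open>
  Fix a point \<open>x\<close>, let \<open>U\<close> be its cylinder of order \<open>N\<close>, let \<open>F\<^sub>s\<close> be the set of points that do
  not visit \<open>U\<close> at the times \<open>0, \<dots>, s - 1\<close>, and \<open>p\<^sub>s = \<mu>(F\<^sub>s)\<close>. Since \<open>\<mu>\<close> is invariant,
  \<open>p\<^sub>s = \<mu>(\<tau>\<^sub>U > s)\<close>, and the mass lost in one step is
  \<open>p\<^sub>s - p\<^sub>s\<^sub>+\<^sub>1 = \<mu>(U \<inter> T\<^sup>-\<^sup>1F\<^sub>s)\<close>, the measure of the points of \<open>U\<close> that do not return
  before time \<open>s + 1\<close>. The proof shows that this is \<open>(\<theta> + o(1)) \<mu>(U) p\<^sub>s\<close> as
  \<open>N \<rightarrow> \<infinity>\<close>, uniformly in all large \<open>s\<close>, with \<open>\<theta> = 1\<close> or \<open>\<theta> = 1 - g\<^sub>m(x)\<close> (lemma \<open>survivor_loss\<close>).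
  Hence \<open>p\<^sub>s\<close> decays at a rate asymptotic to \<open>\<theta> \<mu>(U)\<close>.

  Two effects are behind the estimate of \<open>\<mu>(U \<inter> T\<^sup>-\<^sup>1F\<^sub>s)\<close>.

  \<^item> Short returns. If \<open>T\<^sup>jx \<noteq> x\<close>, then for large \<open>N\<close> no point of \<open>U\<close> returns at time \<open>j\<close>. If
    \<open>x\<close> has period \<open>m\<close>, the points of \<open>U\<close> that return at time \<open>m\<close> are those of the cylinder of order
    \<open>N + m\<close>, and they are a proportion of about \<open>g\<^sub>m(x)\<close>. So let \<open>G\<close> be \<open>U\<close>, or \<open>U\<close> without that
    smaller cylinder. For points of \<open>G\<close>, returns between a large fixed time and time \<open>N + m\<close> are
    rare, because the measures of the cylinders of \<open>x\<close> decay exponentially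
    (\<open>cyl_at_exponential_decay\<close>). This needs \<open>\<mu>\<close> to have no atoms. By ergodicity, an atom forces \<open>x\<close>
    to be a periodic atom (\<open>atom_forces_periodic_atom\<close>), and then \<open>g\<^sub>m(x) < 1\<close> is impossible.

  \<^item> Loss of memory. After time \<open>N + m\<close>, the points of \<open>G\<close> have forgotten where they started:
    \<open>\<mu>(G \<inter> T\<^sup>-\<^sup>(\<^sup>N\<^sup>+\<^sup>m\<^sup>)F\<^sub>s)\<close> is close to \<open>\<mu>(G) p\<^sub>s\<close>, with a relative error that is uniform
    in \<open>s\<close> (\<open>surv_decouples\<close>).

  Ergodicity does not imply mixing, so the loss of memory can fail for arbitrary sets. What makes
  it true is that \<open>F\<^sub>s\<close> is nearly invariant: it differs from \<open>T\<^sup>-\<^sup>kF\<^sub>s\<close>, for bounded \<open>k\<close>,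
  by a small fraction of \<open>p\<^sub>s\<close> (\<open>surv_nearly_invariant\<close>). For a nearly invariant set \<open>E\<close> the
  conditional probability \<open>v(C) = \<mu>(T\<^sup>-\<^sup>nE | C)\<close> of an \<open>n\<close>-cylinder \<open>C\<close> is nearly the average of
  its values at the cylinders of order \<open>n + k\<close> inside \<open>C\<close>. By ergodicity, a definite
  proportion of the descendants of any \<open>C\<close> passes through one fixed cylinder \<open>W\<close> within bounded
  time (\<open>uniform_hitting\<close>). By bounded distortion, \<open>v\<close> is nearly the same at all descendants whose
  last symbols spell \<open>W\<close> (\<open>forget_past\<close>). A maximum principle then shows that \<open>v\<close> is nearly
  constant (\<open>maximum_principle\<close>), so it is close to its mean \<open>\<mu>(E)\<close>
  (\<open>nearly_invariant_decouples\<close>).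

  The escape rate to \<open>U\<close> exists because bounded distortion gives
  \<open>p\<^sub>s\<^sub>+\<^sub>t\<^sub>+\<^sub>N \<le> D p\<^sub>s p\<^sub>t\<close>, so that \<open>- ln p\<^sub>t\<close> is superadditive up to bounded errors
  (\<open>survival_rate_converges\<close>).
\<close>


section \<open>Real sequences\<close>

text \<open>
  The abstract maximum principle: if every value of \<open>f\<close> is, up to an error \<open>e\<close>, an average
  that gives weight at least \<open>\<delta>\<close> to numbers below \<open>a\<close>, then the supremum of \<open>f\<close> cannot
  exceed \<open>a\<close> by more than \<open>e / \<delta>\<close>. Stating the step for every upper bound
  \<open>c \<ge> a\<close> keeps the supremum out of the hypotheses.
\<close>

lemma sup_contraction:
  fixes f :: "'s \<Rightarrow> real"
  assumes bounded: "\<And>s. s \<in> S \<Longrightarrow> f s \<le> B"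
    and \<delta>: "0 < \<delta>" and e: "0 \<le> e"
    and step: "\<And>c s. s \<in> S \<Longrightarrow> a \<le> c \<Longrightarrow> (\<And>t. t \<in> S \<Longrightarrow> f t \<le> c) \<Longrightarrow> f s \<le> c - \<delta> * (c - a) + e"
    and s: "s \<in> S"
  shows "f s \<le> a + e / \<delta>"
proof -
  let ?V = "SUP t\<in>S. f t"
  have le: "f t \<le> ?V" if "t \<in> S" for t
    using that bounded by (intro cSUP_upper bdd_aboveI2) auto
  have "?V \<le> a + e / \<delta>"
  proof (cases "?V \<le> a")
    case True
    then show ?thesis using \<delta> e by (simp add: add_increasing2)
  next
    case False
    have "f t \<le> ?V - \<delta> * (?V - a) + e" if "t \<in> S" for t
      using False by (intro step[OF that] le) auto
    then have "?V \<le> ?V - \<delta> * (?V - a) + e"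
      using s by (intro cSUP_least) auto
    then have "\<delta> * (?V - a) \<le> e" by simp
    then show ?thesis using \<delta> by (simp add: field_simps)
  qed
  with le[OF s] show ?thesis by linarith
qed

lemma geometric_if_halving:
  fixes a :: "nat \<Rightarrow> real"
  assumes le_1: "\<And>n. a n \<le> 1" and k: "1 \<le> k" and half: "\<And>n. 1 \<le> n \<Longrightarrow> a (n + k) \<le> a n / 2"
  obtains \<gamma> where "0 < \<gamma>" "\<gamma> < 1" "\<And>n. a n \<le> 2 * \<gamma> ^ n"
proof -
  define \<gamma> where "\<gamma> = root k (1 / 2)"
  have \<gamma>: "0 < \<gamma>" "\<gamma> < 1" "\<gamma> ^ k = 1 / 2"
    using k by (auto simp: \<gamma>_def)
  have "a n \<le> 2 * \<gamma> ^ n" for n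
  proof (induction n rule: less_induct)
    case (less n)
    show ?case
    proof (cases "n \<le> k")
      case True
      then have "\<gamma> ^ k \<le> \<gamma> ^ n" using \<gamma> by (intro power_decreasing) auto
      with \<gamma>(3) le_1[of n] show ?thesis by simp
    next
      case False
      have "a n \<le> a (n - k) / 2" using False half[of "n - k"] by simp
      also have "\<dots> \<le> \<gamma> ^ (n - k)" using less.IH[of "n - k"] False k by simp
      also have "\<dots> = 2 * (\<gamma> ^ (n - k) * \<gamma> ^ k)" using \<gamma>(3) by simp
      also have "\<dots> = 2 * \<gamma> ^ n" using False by (simp flip: power_add)
      finally show ?thesis .
    qed
  qed
  with \<gamma> that show ?thesis by blast
qed

lemma geometric_sum_le:
  fixes \<gamma> :: real
  assumes \<gamma>: "0 < \<gamma>" "\<gamma> < 1" and "m \<le> a"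
  shows "(\<Sum>j=a..<b. \<gamma> ^ (j - m)) \<le> \<gamma> ^ (a - m) / (1 - \<gamma>)"
proof (cases "a \<le> b")
  case True
  then have "(1 - \<gamma>) * (\<Sum>j=a..<b. \<gamma> ^ (j - m)) = \<gamma> ^ (a - m) - \<gamma> ^ (b - m)"
  proof (induction b rule: dec_induct)
    case (step n)
    then have "Suc n - m = Suc (n - m)" using assms by simp
    with step show ?case by (simp add: distrib_left) (simp add: algebra_simps)
  qed simp
  also have "\<dots> \<le> \<gamma> ^ (a - m)" using \<gamma> by simp
  finally show ?thesis using \<gamma> by (simp add: pos_le_divide_eq mult.commute)
qed (use \<gamma> in simp)

text \<open>
  Fekete's lemma with a gap \<open>N\<close> and a bounded defect \<open>K\<close>: the sequence \<open>b t - K\<close>, regarded as a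
  function of \<open>t + N\<close>, is superadditive, so the limit is the supremum of \<open>(b t - K) / (t + N)\<close>.
\<close>

lemma almost_superadditive_converges:
  fixes b :: "nat \<Rightarrow> real"
  assumes nonneg: "\<And>n. 0 \<le> b n" and mono: "incseq b" and N: "1 \<le> N"
    and bound: "\<And>n. b n \<le> A + B * real n"
    and super: "\<And>s t. b s + b t - K \<le> b (s + t + N)"
  shows "convergent (\<lambda>n. b n / real n)"
proof -
  define r where "r t = (b t - K) / real (t + N)" for t
  define L where "L = (SUP t. r t)"
  have r_eq: "b t - K = r t * real (t + N)" for t using N by (simp add: r_def)
  have "r t \<le> \<bar>A\<bar> + \<bar>B\<bar> + \<bar>K\<bar>" for t
  proof -
    have "b t - K \<le> \<bar>A\<bar> * 1 + \<bar>B\<bar> * real t + \<bar>K\<bar> * 1"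
      using bound[of t] mult_right_mono[OF abs_ge_self[of B], of "real t"] by linarith
    also have "\<dots> \<le> \<bar>A\<bar> * real (t + N) + \<bar>B\<bar> * real (t + N) + \<bar>K\<bar> * real (t + N)"
      using N by (intro add_mono mult_left_mono) auto
    also have "\<dots> = (\<bar>A\<bar> + \<bar>B\<bar> + \<bar>K\<bar>) * real (t + N)" by (simp add: algebra_simps)
    finally show ?thesis using N by (simp add: r_def pos_divide_le_eq)
  qed
  then have bdd: "bdd_above (range r)" by (intro bdd_aboveI2) auto
  have r_le: "r t \<le> L" for t unfolding L_def by (intro cSUP_upper bdd) auto
  have iterate: "real q * (b t - K) \<le> b (q * (t + N))" for q t
  proof (induction q)
    case (Suc q)
    have "real (Suc q) * (b t - K) = real q * (b t - K) + (b t - K)" by (simp add: algebra_simps)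
    also have "\<dots> \<le> b (q * (t + N)) + b t - K" using Suc by simp
    also have "\<dots> \<le> b (q * (t + N) + t + N)" by (rule super)
    finally show ?case by (simp add: algebra_simps)
  qed (simp add: nonneg)
  have "(\<lambda>n. b n / real n) \<longlonglongrightarrow> L"
  proof (rule order_tendstoI)
    fix c assume "L < c"
    have lim: "(\<lambda>n. (K + L * real N) / real n + L) \<longlonglongrightarrow> 0 + L"
      by (intro tendsto_add tendsto_const lim_const_over_n)
    have "\<forall>\<^sub>F n in sequentially. (K + L * real N) / real n + L < c"
      using order_tendstoD(2)[OF lim] \<open>L < c\<close> by simp
    then show "\<forall>\<^sub>F n in sequentially. b n / real n < c"
      using eventually_gt_at_top[of 0]
    proof eventually_elim
      case (elim n)
      have "b n - K \<le> L * real (n + N)" unfolding r_eq by (intro mult_right_mono r_le) simp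
      then have "b n \<le> (K + L * real N) + L * real n" by (simp add: algebra_simps)
      then have "b n / real n \<le> (K + L * real N) / real n + L"
        using elim(2) by (simp add: field_simps)
      with elim(1) show ?case by simp
    qed
  next
    fix c assume "c < L"
    then obtain t where t: "c < r t" using less_cSUP_iff[OF _ bdd, of c] by (auto simp: L_def)
    show "\<forall>\<^sub>F n in sequentially. c < b n / real n"
    proof (cases "0 \<le> b t - K")
      case False
      then have "r t < 0" using N by (simp add: r_def divide_neg_pos)
      then have "c < b n / real n" for n using t nonneg[of n] by (smt (verit) divide_nonneg_nonneg of_nat_0_le_iff)
      then show ?thesis by simp
    next
      case True
      have lim: "(\<lambda>n. r t - (b t - K) / real n) \<longlonglongrightarrow> r t - 0"
        by (intro tendsto_diff tendsto_const lim_const_over_n)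
      have "\<forall>\<^sub>F n in sequentially. c < r t - (b t - K) / real n"
        using order_tendstoD(1)[OF lim] t by simp
      then show ?thesis
        using eventually_gt_at_top[of 0]
      proof eventually_elim
        case (elim n)
        define q where "q = n div (t + N)"
        have "n mod (t + N) < t + N" using N by simp
        then have "n \<le> q * (t + N) + (t + N)"
          using div_mult_mod_eq[of n "t + N"] unfolding q_def by linarith
        then have "real n \<le> real (q * (t + N) + (t + N))" by (rule of_nat_mono)
        also have "\<dots> = (real q + 1) * real (t + N)" by (simp add: algebra_simps)
        finally have "real n \<le> (real q + 1) * real (t + N)" .
        then have "real n * r t \<le> (real q + 1) * real (t + N) * r t"
          using True N by (intro mult_right_mono) (auto simp: r_def)
        also have "\<dots> = real q * (b t - K) + (b t - K)" unfolding r_eq by (simp add: algebra_simps)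
        finally have "real n * r t \<le> b (q * (t + N)) + (b t - K)"
          using iterate[of q t] by linarith
        also have "b (q * (t + N)) \<le> b n"
          unfolding q_def by (rule incseqD[OF mono]) simp
        finally have "r t \<le> (b n + (b t - K)) / real n"
          using elim(2) by (simp add: pos_le_divide_eq mult.commute)
        then have "r t - (b t - K) / real n \<le> b n / real n"
          by (simp only: add_divide_distrib)
        with elim(1) show ?case by linarith
      qed
    qed
  qed
  then show ?thesis by (rule convergentI)
qed

text \<open>
  The relative loss per step determines the rate up to the estimates
  \<open>a \<le> - ln (1 - a)\<close> and \<open>- ln (1 - b) \<le> b / (1 - b)\<close>. Both agree to first order, which is all
  that matters when \<open>a\<close> and \<open>b\<close> are multiples of \<open>\<mu>(U)\<close>.
\<close>

lemma exponential_rate_bounds: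
  fixes p :: "nat \<Rightarrow> real"
  assumes pos: "\<And>s. 0 < p s" and ab: "a < 1" "b < 1"
    and lower: "\<And>s. m \<le> s \<Longrightarrow> a * p s \<le> p s - p (Suc s)"
    and upper: "\<And>s. m \<le> s \<Longrightarrow> p s - p (Suc s) \<le> b * p s"
    and lim: "(\<lambda>t. - ln (p t) / real t) \<longlonglongrightarrow> l"
  shows "a \<le> l" and "l \<le> b / (1 - b)"
proof -
  have lim': "(\<lambda>n. - ln (p (n + m)) / real (n + m)) \<longlonglongrightarrow> l"
    using lim by (rule LIMSEQ_ignore_initial_segment)
  have drift: "(\<lambda>n. (c + real n * \<beta>) / real (n + m)) \<longlonglongrightarrow> \<beta>" for c \<beta> :: real
  proof -
    have "(\<lambda>n. (c - real m * \<beta>) / real n + \<beta>) \<longlonglongrightarrow> 0 + \<beta>"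
      by (intro tendsto_add tendsto_const lim_const_over_n)
    then have "(\<lambda>n. (c - real m * \<beta>) / real (n + m) + \<beta>) \<longlonglongrightarrow> 0 + \<beta>"
      by (rule LIMSEQ_ignore_initial_segment)
    moreover have "\<forall>\<^sub>F n in sequentially. (c - real m * \<beta>) / real (n + m) + \<beta> = (c + real n * \<beta>) / real (n + m)"
      using eventually_gt_at_top[of 0] by eventually_elim (simp add: field_simps)
    ultimately have "(\<lambda>n. (c + real n * \<beta>) / real (n + m)) \<longlonglongrightarrow> 0 + \<beta>"
      by (rule Lim_transform_eventually)
    then show ?thesis by simp
  qed
  have le: "p (n + m) \<le> (1 - a) ^ n * p m" for n
  proof (induction n)
    case (Suc n)
    have "p (Suc n + m) \<le> (1 - a) * p (n + m)" using lower[of "n + m"] by (simp add: algebra_simps)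
    also have "\<dots> \<le> (1 - a) * ((1 - a) ^ n * p m)" using ab Suc by (intro mult_left_mono) auto
    finally show ?case by simp
  qed simp
  have ge: "(1 - b) ^ n * p m \<le> p (n + m)" for n
  proof (induction n)
    case (Suc n)
    have "(1 - b) * ((1 - b) ^ n * p m) \<le> (1 - b) * p (n + m)" using ab Suc by (intro mult_left_mono) auto
    also have "\<dots> \<le> p (Suc n + m)" using upper[of "n + m"] by (simp add: algebra_simps)
    finally show ?case by simp
  qed simp
  have 1: "- ln (p m) + real n * (- ln (1 - a)) \<le> - ln (p (n + m))" for n
  proof -
    have "ln (p (n + m)) \<le> ln ((1 - a) ^ n * p m)" using le[of n] pos ab by simp
    also have "\<dots> = real n * ln (1 - a) + ln (p m)" using pos[of m] ab by (simp add: ln_mult ln_realpow)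
    finally show ?thesis by simp
  qed
  have "- ln (1 - a) \<le> l"
    by (intro LIMSEQ_le[OF drift[of "- ln (p m)"] lim'] exI[of _ 0] allI impI divide_right_mono 1) simp
  moreover have "ln (1 - a) \<le> - a" using ab ln_le_minus_one[of "1 - a"] by simp
  ultimately show "a \<le> l" by linarith
  have 2: "- ln (p (n + m)) \<le> - ln (p m) + real n * (- ln (1 - b))" for n
  proof -
    have "real n * ln (1 - b) + ln (p m) = ln ((1 - b) ^ n * p m)"
      using pos[of m] ab by (simp add: ln_mult ln_realpow)
    also have "\<dots> \<le> ln (p (n + m))" using ge[of n] pos ab by (simp add: mult_pos_pos)
    finally show ?thesis by simp
  qed
  have "l \<le> - ln (1 - b)"
    by (intro LIMSEQ_le[OF lim' drift[of "- ln (p m)"]] exI[of _ 0] allI impI divide_right_mono 2) simp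
  also have "- ln (1 - b) = ln (1 / (1 - b))" using ab by (simp add: ln_div)
  also have "\<dots> \<le> 1 / (1 - b) - 1" using ab by (intro ln_le_minus_one) simp
  also have "\<dots> = b / (1 - b)" using ab by (simp add: field_simps)
  finally show "l \<le> b / (1 - b)" .
qed

section \<open>The setting\<close>

text \<open>
  The constant \<open>D\<close> of the distortion property is made a parameter, so that the bounds below can
  name it.
\<close>

locale ergodic_gibbs_markov = prob_space M
  for M :: "'a measure" +
  fixes T :: "'a \<Rightarrow> 'a" and P :: "'a set set" and g :: "'a \<Rightarrow> real" and lam D :: real
  assumes markov: "markov_map M T P"
    and preserving: "measure_preserving_map M T"
    and jacobian: "inverse_jacobian M T P g"
    and ergodic: "ergodic M T"
    and lam: "0 < lam" "lam < 1"
    and D: "1 < D"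
    and distortion: "\<And>n C y z. 1 \<le> n \<Longrightarrow> C \<in> cylinders M T P n \<Longrightarrow> y \<in> C \<Longrightarrow> z \<in> C \<Longrightarrow>
        \<bar>cocycle_prod T g n y / cocycle_prod T g n z - 1\<bar>
          \<le> D * cylinder_dist lam M T P ((T ^^ n) y) ((T ^^ n) z)"
    and gibbs: "\<And>n z. 1 \<le> n \<Longrightarrow> z \<in> space M \<Longrightarrow>
        1 / D \<le> measure M (cylinder_of M T P n z) / cocycle_prod T g n z"
        "\<And>n z. 1 \<le> n \<Longrightarrow> z \<in> space M \<Longrightarrow>
        measure M (cylinder_of M T P n z) / cocycle_prod T g n z \<le> D"
begin

abbreviation cyl :: "nat \<Rightarrow> 'a set set" where
  "cyl n \<equiv> cylinders M T P n"

abbreviation cyl_at :: "nat \<Rightarrow> 'a \<Rightarrow> 'a set" where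
  "cyl_at n z \<equiv> cylinder_of M T P n z"

abbreviation pre :: "nat \<Rightarrow> 'a set \<Rightarrow> 'a set" where
  "pre n E \<equiv> (T ^^ n) -` E \<inter> space M"

abbreviation jac :: "nat \<Rightarrow> 'a \<Rightarrow> real" where
  "jac n z \<equiv> cocycle_prod T g n z"

section \<open>Iterates and cylinders\<close>

lemma T_measurable [measurable]: "T \<in> measurable M M"
  using markov by (simp add: markov_map_def)

lemma funpow_measurable [measurable]: "T ^^ n \<in> measurable M M"
  by (induction n) (auto intro: measurable_comp[OF _ T_measurable] simp: comp_def)

lemma funpow_in_space: "z \<in> space M \<Longrightarrow> (T ^^ n) z \<in> space M"
  using funpow_measurable[of n] by (auto simp: measurable_def)

lemma pre_sets [measurable]: "E \<in> sets M \<Longrightarrow> pre n E \<in> sets M"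
  using funpow_measurable[of n] by (auto simp: measurable_def)

lemma distr_funpow: "distr M M (T ^^ n) = M"
proof (induction n)
  case 0
  show ?case by (simp add: id_def distr_id)
next
  case (Suc n)
  have "distr M M (T ^^ Suc n) = distr (distr M M (T ^^ n)) M T"
    by (simp add: distr_distr)
  also have "\<dots> = M"
    using preserving by (simp add: Suc measure_preserving_map_def)
  finally show ?case .
qed

lemma measure_pre: "E \<in> sets M \<Longrightarrow> measure M (pre n E) = measure M E"
  using measure_distr[of "T ^^ n" M M E] by (simp add: distr_funpow)

lemma pre_pre: "pre n (pre k E) = pre (n + k) E"
  by (auto simp: funpow_in_space funpow_add add.commute[of n k])

lemma pre_mono: "E \<subseteq> F \<Longrightarrow> pre n E \<subseteq> pre n F"
  by auto

lemma partition_P: "partition_on (space M) P"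
  and countable_P: "countable P"
  and sets_P: "A \<in> P \<Longrightarrow> A \<in> sets M"
  and inj_on_P: "A \<in> P \<Longrightarrow> inj_on T A"
  and image_P: "A \<in> P \<Longrightarrow> \<exists>Q\<subseteq>P. T ` A = \<Union>Q"
  and measure_P: "A \<in> P \<Longrightarrow> 0 < measure M A"
  using markov by (auto simp: markov_map_def)

lemma P_disjoint: "A \<in> P \<Longrightarrow> B \<in> P \<Longrightarrow> z \<in> A \<Longrightarrow> z \<in> B \<Longrightarrow> A = B"
  using partition_P by (auto simp: partition_on_def disjoint_def)

lemma P_cover: "z \<in> space M \<Longrightarrow> \<exists>A\<in>P. z \<in> A"
  using partition_P by (auto simp: partition_on_def)

lemma cyl_cover: "z \<in> space M \<Longrightarrow> \<exists>C\<in>cyl n. z \<in> C"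
proof (induction n)
  case (Suc n)
  then obtain C where C: "C \<in> cyl n" "z \<in> C" by blast
  obtain A where "A \<in> P" "(T ^^ n) z \<in> A"
    using P_cover[OF funpow_in_space[OF Suc.prems]] by blast
  with C show ?case
    by (auto intro!: bexI[of _ "C \<inter> (T ^^ n) -` A"])
qed auto

lemma cyl_disjoint: "B \<in> cyl n \<Longrightarrow> C \<in> cyl n \<Longrightarrow> z \<in> B \<Longrightarrow> z \<in> C \<Longrightarrow> B = C"
proof (induction n arbitrary: B C)
  case (Suc n)
  obtain B' A where B: "B' \<in> cyl n" "A \<in> P" "B = B' \<inter> (T ^^ n) -` A"
    using Suc.prems(1) by auto
  obtain C' A' where C: "C' \<in> cyl n" "A' \<in> P" "C = C' \<inter> (T ^^ n) -` A'"
    using Suc.prems(2) by auto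
  have "B' = C'"
    using Suc.IH[OF B(1) C(1)] Suc.prems(3,4) B C by blast
  moreover have "A = A'"
    using P_disjoint[OF B(2) C(2)] Suc.prems(3,4) B C by blast
  ultimately show ?case using B C by simp
qed auto

lemma cyl_sets: "C \<in> cyl n \<Longrightarrow> C \<in> sets M"
proof (induction n arbitrary: C)
  case (Suc n)
  obtain C' A where C: "C' \<in> cyl n" "A \<in> P" "C = C' \<inter> (T ^^ n) -` A"
    using Suc.prems(1) by auto
  have "C' \<in> sets M" by (rule Suc.IH[OF C(1)])
  then have "C = C' \<inter> pre n A"
    using C(3) sets.sets_into_space by auto
  with \<open>C' \<in> sets M\<close> pre_sets[OF sets_P[OF C(2)]] show ?case by simp
qed auto

lemma cyl_subset_space: "C \<in> cyl n \<Longrightarrow> C \<subseteq> space M"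
  using cyl_sets sets.sets_into_space by blast

lemma cyl_nonempty: "C \<in> cyl n \<Longrightarrow> C \<noteq> {}"
  by (cases n) (auto simp: not_empty)

lemma countable_cyl: "countable (cyl n)"
proof (induction n)
  case (Suc n)
  have "cyl (Suc n) \<subseteq> (\<lambda>(C, A). C \<inter> (T ^^ n) -` A) ` (cyl n \<times> P)"
    by auto
  then show ?case
    by (rule countable_subset) (intro countable_image countable_SIGMA Suc countable_P)
qed auto

lemma cyl_at_eq: "C \<in> cyl n \<Longrightarrow> z \<in> C \<Longrightarrow> cyl_at n z = C"
  unfolding cylinder_of_def by (rule the_equality) (auto dest: cyl_disjoint)

lemma
  assumes "z \<in> space M"
  shows cyl_at_in: "cyl_at n z \<in> cyl n" and in_cyl_at: "z \<in> cyl_at n z"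
proof -
  obtain C where "C \<in> cyl n" "z \<in> C"
    using cyl_cover[OF assms] by blast
  then show "cyl_at n z \<in> cyl n" "z \<in> cyl_at n z"
    by (simp_all add: cyl_at_eq)
qed

lemma cyl_at_sets: "z \<in> space M \<Longrightarrow> cyl_at n z \<in> sets M"
  using cyl_at_in cyl_sets by blast

lemma cyl_at_same: "z \<in> space M \<Longrightarrow> y \<in> cyl_at n z \<Longrightarrow> cyl_at n y = cyl_at n z"
  using cyl_at_eq cyl_at_in by blast

lemma cyl_one: "cyl 1 = P"
proof -
  have 1: "{} \<notin> P"
    using partition_P by (auto simp: partition_on_def)
  have 2: "space M \<inter> A = A" if "A \<in> P" for A
    using sets.sets_into_space[OF sets_P[OF that]] by blast
  have "cyl 1 = {space M \<inter> A |A. A \<in> P} - {{}}"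
    by simp
  also have "{space M \<inter> A |A. A \<in> P} = P"
    using 2 by force
  finally show ?thesis using 1 by simp
qed

lemma cyl_join: "C \<in> cyl n \<Longrightarrow> B \<in> cyl k \<Longrightarrow> C \<inter> pre n B \<noteq> {} \<Longrightarrow> C \<inter> pre n B \<in> cyl (n + k)"
proof (induction k arbitrary: B)
  case 0
  then have "C \<inter> pre n B = C"
    using cyl_subset_space[OF 0(1)] by (auto simp: funpow_in_space)
  with 0 show ?case by simp
next
  case (Suc k)
  obtain B' A where B: "B' \<in> cyl k" "A \<in> P" "B = B' \<inter> (T ^^ k) -` A"
    using Suc.prems(2) by auto
  have eq: "C \<inter> pre n B = (C \<inter> pre n B') \<inter> (T ^^ (n + k)) -` A"
    by (auto simp: B(3) funpow_add add.commute[of n k])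
  have "C \<inter> pre n B' \<noteq> {}"
    using Suc.prems(3) eq by blast
  with Suc.prems(1) B(1) have "C \<inter> pre n B' \<in> cyl (n + k)"
    by (rule Suc.IH)
  then have "(C \<inter> pre n B') \<inter> (T ^^ (n + k)) -` A \<in> cyl (Suc (n + k))"
    using B(2) Suc.prems(3) unfolding eq cylinders.simps by blast
  then show ?case by (simp only: eq add_Suc_right)
qed

text \<open>
  The first \<open>n + k\<close> symbols of \<open>z\<close> are its first \<open>n\<close> symbols followed by the first \<open>k\<close> symbols
  of \<open>T\<^sup>nz\<close>.
\<close>

lemma cyl_at_add:
  assumes z: "z \<in> space M"
  shows "cyl_at (n + k) z = cyl_at n z \<inter> pre n (cyl_at k ((T ^^ n) z))"
proof (rule cyl_at_eq)
  have Tz: "(T ^^ n) z \<in> space M" by (rule funpow_in_space[OF z])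
  show 1: "z \<in> cyl_at n z \<inter> pre n (cyl_at k ((T ^^ n) z))"
    using in_cyl_at[OF z] in_cyl_at[OF Tz] z by auto
  show "cyl_at n z \<inter> pre n (cyl_at k ((T ^^ n) z)) \<in> cyl (n + k)"
    using cyl_join[OF cyl_at_in[OF z] cyl_at_in[OF Tz]] 1 by blast
qed

lemma cyl_at_antimono: "z \<in> space M \<Longrightarrow> n \<le> k \<Longrightarrow> cyl_at k z \<subseteq> cyl_at n z"
  using cyl_at_add[of z n "k - n"] by auto

lemma Inter_cyl_at: "z \<in> space M \<Longrightarrow> (\<Inter>n. cyl_at n z) = {z}"
  using markov by (auto simp: markov_map_def generating_def)

text \<open>
  The Markov property for cylinders. An image \<open>T\<^sup>nC\<close> cannot cut an element of \<open>P\<close>: the last symbol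
  of \<open>C\<close> alone determines \<open>T\<^sup>nC\<close>.
\<close>

lemma image_cyl:
  assumes "C \<in> cyl n" "A \<in> P" "A \<inter> (T ^^ n) ` C \<noteq> {}"
  shows "A \<subseteq> (T ^^ n) ` C"
  using assms
proof (induction n arbitrary: C A)
  case 0
  then show ?case using partition_P by (auto simp: partition_on_def)
next
  case (Suc n)
  obtain C' B where C: "C' \<in> cyl n" "B \<in> P" "C = C' \<inter> (T ^^ n) -` B"
    using Suc.prems(1) by auto
  have "B \<inter> (T ^^ n) ` C' \<noteq> {}"
    using Suc.prems(3) C by auto
  from Suc.IH[OF C(1,2) this] have "(T ^^ n) ` C = B"
    using C(3) by auto
  then have eq: "(T ^^ Suc n) ` C = T ` B"
    by (metis funpow.simps(2) image_comp)
  obtain Q where Q: "Q \<subseteq> P" "T ` B = \<Union>Q"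
    using image_P[OF C(2)] by blast
  show ?case
    using Suc.prems(2,3) Q P_disjoint unfolding eq by blast
qed

section \<open>Change of variables along cylinders\<close>

lemma image_sets: "A \<in> P \<Longrightarrow> E \<in> sets M \<Longrightarrow> E \<subseteq> A \<Longrightarrow> T ` E \<in> sets M"
  and g_measurable [measurable]: "g \<in> borel_measurable M"
  and g_pos: "z \<in> space M \<Longrightarrow> 0 < g z"
  and density_forward: "density (forward_measure M T P) (\<lambda>z. ennreal (g z)) = M"
  using jacobian by (auto simp: inverse_jacobian_def)

lemma sets_forward [simp, measurable_cong]: "sets (forward_measure M T P) = sets M"
  and space_forward [simp]: "space (forward_measure M T P) = space M"
  by (simp_all add: forward_measure_def)

text \<open>
  Injectivity of \<open>T\<close> on the elements of \<open>P\<close> keeps the images of disjoint sets disjoint, so the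
  set function in the definition of \<open>forward_measure\<close> really is a measure.
\<close>

lemma emeasure_forward:
  assumes E: "E \<in> sets M"
  shows "emeasure (forward_measure M T P) E = (\<integral>\<^sup>+A. emeasure M (T ` (E \<inter> A)) \<partial>count_space P)"
  unfolding forward_measure_def
proof (rule emeasure_measure_of_sigma)
  show "sigma_algebra (space M) (sets M)" ..
  show "positive (sets M) (\<lambda>E. \<integral>\<^sup>+A. emeasure M (T ` (E \<inter> A)) \<partial>count_space P)"
    by (simp add: positive_def)
  show "countably_additive (sets M) (\<lambda>E. \<integral>\<^sup>+A. emeasure M (T ` (E \<inter> A)) \<partial>count_space P)"
  proof (rule countably_additiveI)
    fix F :: "nat \<Rightarrow> 'a set"
    assume F: "range F \<subseteq> sets M" "disjoint_family F"
    have "(\<Sum>i. \<integral>\<^sup>+A. emeasure M (T ` (F i \<inter> A)) \<partial>count_space P)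
        = (\<integral>\<^sup>+A. (\<Sum>i. emeasure M (T ` (F i \<inter> A))) \<partial>count_space P)"
      by (rule nn_integral_suminf [symmetric]) simp
    also have "\<dots> = (\<integral>\<^sup>+A. emeasure M (T ` ((\<Union>i. F i) \<inter> A)) \<partial>count_space P)"
    proof (rule nn_integral_cong)
      fix A assume "A \<in> space (count_space P)"
      then have A: "A \<in> P" by simp
      have "(\<Sum>i. emeasure M (T ` (F i \<inter> A))) = emeasure M (\<Union>i. T ` (F i \<inter> A))"
      proof (rule suminf_emeasure)
        show "range (\<lambda>i. T ` (F i \<inter> A)) \<subseteq> sets M"
          using F(1) sets_P[OF A] by (intro image_subsetI image_sets[OF A] sets.Int) auto
        show "disjoint_family (\<lambda>i. T ` (F i \<inter> A))"
          using F(2) inj_on_P[OF A] unfolding disjoint_family_on_def inj_on_def by blast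
      qed
      also have "(\<Union>i. T ` (F i \<inter> A)) = T ` ((\<Union>i. F i) \<inter> A)"
        by auto
      finally show "(\<Sum>i. emeasure M (T ` (F i \<inter> A))) = emeasure M (T ` ((\<Union>i. F i) \<inter> A))" .
    qed
    finally show "(\<Sum>i. \<integral>\<^sup>+A. emeasure M (T ` (F i \<inter> A)) \<partial>count_space P)
        = (\<integral>\<^sup>+A. emeasure M (T ` ((\<Union>i. F i) \<inter> A)) \<partial>count_space P)" .
  qed
qed (rule E)

lemma emeasure_forward_branch:
  assumes A: "A \<in> P" and E: "E \<in> sets M" "E \<subseteq> A"
  shows "emeasure (forward_measure M T P) E = emeasure M (T ` E)"
proof -
  have "emeasure M (T ` (E \<inter> B)) = emeasure M (T ` E) * indicator {A} B" if "B \<in> P" for B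
  proof (cases "B = A")
    case False
    then have "E \<inter> B = {}"
      using P_disjoint[OF A that] E by auto
    with False show ?thesis by simp
  qed (use E in \<open>simp add: Int_absorb2\<close>)
  then have "emeasure (forward_measure M T P) E
      = (\<integral>\<^sup>+B. emeasure M (T ` E) * indicator {A} B \<partial>count_space P)"
    unfolding emeasure_forward[OF E(1)] by (intro nn_integral_cong) simp
  also have "\<dots> = emeasure M (T ` E)"
    using A by (subst nn_integral_cmult_indicator) auto
  finally show ?thesis .
qed

text \<open>
  On \<open>A \<in> P\<close> the forward measure is \<open>\<mu>\<close> transported back along the injective branch \<open>T|\<^sub>A\<close>, and
  \<open>1 / g\<close> is its density with respect to \<open>\<mu>\<close>.
\<close>

lemma branch_change_of_variables:
  assumes A: "A \<in> P" and f [measurable]: "f \<in> borel_measurable M"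
  shows "(\<integral>\<^sup>+z. indicator A z * (f (T z) * ennreal (1 / g z)) \<partial>M) = (\<integral>\<^sup>+y. indicator (T ` A) y * f y \<partial>M)"
proof -
  let ?F = "forward_measure M T P"
  note [measurable] = sets_P[OF A]
  have TA [measurable]: "T ` A \<in> sets M"
    by (rule image_sets[OF A sets_P[OF A] order_refl])
  have "distr (density ?F (indicator A)) M T = density M (indicator (T ` A))"
  proof (rule measure_eqI)
    fix E assume "E \<in> sets (distr (density ?F (indicator A)) M T)"
    then have E [measurable]: "E \<in> sets M" by simp
    have TE: "T -` E \<inter> space M \<in> sets M" by measurable
    have "A \<subseteq> space M"
      using sets.sets_into_space[OF sets_P[OF A]] .
    then have eq: "T ` (A \<inter> (T -` E \<inter> space M)) = T ` A \<inter> E"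
      by auto
    have "emeasure (distr (density ?F (indicator A)) M T) E
        = emeasure (density ?F (indicator A)) (T -` E \<inter> space M)"
      by (subst emeasure_distr) auto
    also have "\<dots> = emeasure ?F (A \<inter> (T -` E \<inter> space M))"
      using TE by (subst emeasure_density_const [of _ _ 1] emeasure_density)
        (auto simp flip: indicator_inter_arith)
    also have "\<dots> = emeasure M (T ` A \<inter> E)"
      using TE eq by (subst emeasure_forward_branch[OF A]) auto
    also have "\<dots> = emeasure (density M (indicator (T ` A))) E"
      by (subst emeasure_density) (auto simp flip: indicator_inter_arith)
    finally show "emeasure (distr (density ?F (indicator A)) M T) E
        = emeasure (density M (indicator (T ` A))) E" .
  qed simp
  then have "(\<integral>\<^sup>+y. f y \<partial>distr (density ?F (indicator A)) M T) = (\<integral>\<^sup>+y. f y \<partial>density M (indicator (T ` A)))"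
    by simp
  then have "(\<integral>\<^sup>+z. indicator A z * f (T z) \<partial>?F) = (\<integral>\<^sup>+y. indicator (T ` A) y * f y \<partial>M)"
    by (simp add: nn_integral_distr nn_integral_density)
  moreover have "(\<integral>\<^sup>+z. indicator A z * (f (T z) * ennreal (1 / g z)) \<partial>M)
      = (\<integral>\<^sup>+z. indicator A z * (f (T z) * ennreal (1 / g z)) \<partial>density ?F (\<lambda>z. ennreal (g z)))"
    by (simp add: density_forward)
  moreover have "\<dots> = (\<integral>\<^sup>+z. ennreal (g z) * (indicator A z * (f (T z) * ennreal (1 / g z))) \<partial>?F)"
    by (rule nn_integral_density) measurable
  moreover have "\<dots> = (\<integral>\<^sup>+z. indicator A z * f (T z) \<partial>?F)"
  proof (rule nn_integral_cong)
    fix z assume "z \<in> space ?F"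
    then have "0 < g z" using g_pos by simp
    then have "ennreal (g z) * ennreal (1 / g z) = 1"
      by (simp add: ennreal_mult' [symmetric])
    moreover have "ennreal (g z) * (indicator A z * (f (T z) * ennreal (1 / g z)))
        = (ennreal (g z) * ennreal (1 / g z)) * (indicator A z * f (T z))"
      by (simp only: mult_ac)
    ultimately show "ennreal (g z) * (indicator A z * (f (T z) * ennreal (1 / g z))) = indicator A z * f (T z)"
      by simp
  qed
  ultimately show ?thesis by simp
qed

lemma jac_Suc: "jac (Suc n) z = jac n z * g ((T ^^ n) z)"
  by (simp add: cocycle_prod_def)

lemma jac_measurable [measurable]: "(\<lambda>z. jac n z) \<in> borel_measurable M"
  unfolding cocycle_prod_def by measurable

lemma jac_pos: "z \<in> space M \<Longrightarrow> 0 < jac n z"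
  unfolding cocycle_prod_def by (intro prod_pos) (auto simp: g_pos funpow_in_space)

text \<open>
  Iterating the change of variables along the branches that make up \<open>T\<^sup>n\<close> on \<open>C\<close>. All distortion
  estimates below are obtained by taking an indicator for \<open>f\<close> and bounding \<open>1 / g\<^sub>n\<close>.
\<close>

lemma cylinder_change_of_variables:
  assumes "C \<in> cyl n" and "f \<in> borel_measurable M"
  shows "(\<integral>\<^sup>+z. indicator C z * (f ((T ^^ n) z) * ennreal (1 / jac n z)) \<partial>M)
      = (\<integral>\<^sup>+y. indicator ((T ^^ n) ` C) y * f y \<partial>M)"
  using assms
proof (induction n arbitrary: C f)
  case 0
  then show ?case by (simp add: cocycle_prod_def)
next
  case (Suc n)
  note f [measurable] = Suc.prems(2)
  obtain C' A where C: "C' \<in> cyl n" "A \<in> P" "C = C' \<inter> (T ^^ n) -` A"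
    using Suc.prems(1) by auto
  have [measurable]: "A \<in> sets M" by (rule sets_P[OF C(2)])
  have "C \<noteq> {}" by (rule cyl_nonempty[OF Suc.prems(1)])
  then have "A \<inter> (T ^^ n) ` C' \<noteq> {}" using C(3) by auto
  then have A: "A \<subseteq> (T ^^ n) ` C'" by (rule image_cyl[OF C(1,2)])
  then have "(T ^^ n) ` C = A" using C(3) by auto
  then have img: "(T ^^ Suc n) ` C = T ` A" by (metis funpow.simps(2) image_comp)
  let ?h = "\<lambda>y. indicator A y * (f (T y) * ennreal (1 / g y))"
  have "(\<integral>\<^sup>+z. indicator C z * (f ((T ^^ Suc n) z) * ennreal (1 / jac (Suc n) z)) \<partial>M)
      = (\<integral>\<^sup>+z. indicator C' z * (?h ((T ^^ n) z) * ennreal (1 / jac n z)) \<partial>M)"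
  proof (rule nn_integral_cong)
    fix z assume z: "z \<in> space M"
    have "ennreal (1 / jac (Suc n) z) = ennreal (1 / g ((T ^^ n) z)) * ennreal (1 / jac n z)"
      using jac_pos[OF z, of n] g_pos[OF funpow_in_space[OF z, of n]]
      by (simp add: jac_Suc ennreal_mult' [symmetric] mult.commute)
    moreover have "indicator C z = (indicator C' z * indicator A ((T ^^ n) z) :: ennreal)"
      by (simp add: C(3) indicator_def)
    ultimately show "indicator C z * (f ((T ^^ Suc n) z) * ennreal (1 / jac (Suc n) z))
        = indicator C' z * (?h ((T ^^ n) z) * ennreal (1 / jac n z))"
      by (simp add: mult.assoc)
  qed
  also have "\<dots> = (\<integral>\<^sup>+y. indicator ((T ^^ n) ` C') y * ?h y \<partial>M)"
    by (rule Suc.IH[OF C(1)]) measurable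
  also have "\<dots> = (\<integral>\<^sup>+y. ?h y \<partial>M)"
    using A by (intro nn_integral_cong) (auto simp: indicator_def)
  also have "\<dots> = (\<integral>\<^sup>+y. indicator ((T ^^ Suc n) ` C) y * f y \<partial>M)"
    unfolding img by (rule branch_change_of_variables[OF C(2)]) measurable
  finally show ?case .
qed

lemma nn_integral_inverse_jac:
  assumes C: "C \<in> cyl n" and E: "E \<in> sets M"
  shows "(\<integral>\<^sup>+z. indicator (C \<inter> pre n E) z * ennreal (1 / jac n z) \<partial>M)
      = (\<integral>\<^sup>+y. indicator ((T ^^ n) ` C) y * indicator E y \<partial>M)"
proof -
  have "(\<integral>\<^sup>+z. indicator (C \<inter> pre n E) z * ennreal (1 / jac n z) \<partial>M)
      = (\<integral>\<^sup>+z. indicator C z * (indicator E ((T ^^ n) z) * ennreal (1 / jac n z)) \<partial>M)"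
    by (intro nn_integral_cong) (auto simp: indicator_def)
  also have "\<dots> = (\<integral>\<^sup>+y. indicator ((T ^^ n) ` C) y * indicator E y \<partial>M)"
    using E by (intro cylinder_change_of_variables[OF C]) simp
  finally show ?thesis .
qed

lemma cyl_pre_sets [measurable]: "C \<in> cyl n \<Longrightarrow> E \<in> sets M \<Longrightarrow> C \<inter> pre k E \<in> sets M"
  using cyl_sets pre_sets by blast

lemma measure_cyl_pre_le:
  assumes C: "C \<in> cyl n" and E: "E \<in> sets M" and b: "\<And>z. z \<in> C \<inter> pre n E \<Longrightarrow> jac n z \<le> b" and b0: "0 \<le> b"
  shows "measure M (C \<inter> pre n E) \<le> b * measure M E"
proof -
  have S: "C \<inter> pre n E \<in> sets M" by (rule cyl_pre_sets[OF C E])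
  have "ennreal (measure M (C \<inter> pre n E)) = (\<integral>\<^sup>+z. indicator (C \<inter> pre n E) z \<partial>M)"
    using S by (simp add: emeasure_eq_measure)
  also have "\<dots> \<le> (\<integral>\<^sup>+z. ennreal b * (indicator (C \<inter> pre n E) z * ennreal (1 / jac n z)) \<partial>M)"
  proof (rule nn_integral_mono)
    fix z assume z: "z \<in> space M"
    show "indicator (C \<inter> pre n E) z \<le> ennreal b * (indicator (C \<inter> pre n E) z * ennreal (1 / jac n z))"
    proof (cases "z \<in> C \<inter> pre n E")
      case True
      then have "1 \<le> b * (1 / jac n z)"
        using b[OF True] jac_pos[OF z, of n] by (simp add: field_simps)
      then show ?thesis
        using True b0 by (simp add: ennreal_mult' [symmetric])
    qed simp
  qed
  also have "\<dots> = ennreal b * (\<integral>\<^sup>+y. indicator ((T ^^ n) ` C) y * indicator E y \<partial>M)"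
    using S by (subst nn_integral_cmult) (auto simp: nn_integral_inverse_jac[OF C E])
  also have "\<dots> \<le> ennreal b * (\<integral>\<^sup>+y. indicator E y \<partial>M)"
    by (intro mult_left_mono nn_integral_mono) (auto simp: indicator_def)
  also have "\<dots> = ennreal (b * measure M E)"
    using E b0 by (simp add: emeasure_eq_measure ennreal_mult)
  finally show ?thesis
    using b0 by (simp add: ennreal_le_iff)
qed

lemma measure_cyl_pre_ge:
  assumes C: "C \<in> cyl n" and E: "E \<in> sets M" "E \<subseteq> (T ^^ n) ` C"
    and a: "\<And>z. z \<in> C \<inter> pre n E \<Longrightarrow> a \<le> jac n z"
  shows "a * measure M E \<le> measure M (C \<inter> pre n E)"
proof (cases "0 < a")
  case True
  have S: "C \<inter> pre n E \<in> sets M" by (rule cyl_pre_sets[OF C E(1)])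
  have "ennreal (a * measure M E) = ennreal a * (\<integral>\<^sup>+y. indicator E y \<partial>M)"
    using True E by (simp add: emeasure_eq_measure ennreal_mult)
  also have "(\<integral>\<^sup>+y. indicator E y \<partial>M) = (\<integral>\<^sup>+y. indicator ((T ^^ n) ` C) y * indicator E y \<partial>M)"
    using E(2) by (intro nn_integral_cong) (auto simp: indicator_def)
  also have "ennreal a * \<dots> = (\<integral>\<^sup>+z. ennreal a * (indicator (C \<inter> pre n E) z * ennreal (1 / jac n z)) \<partial>M)"
    using S by (subst nn_integral_cmult) (auto simp: nn_integral_inverse_jac[OF C E(1)])
  also have "\<dots> \<le> (\<integral>\<^sup>+z. indicator (C \<inter> pre n E) z \<partial>M)"
  proof (rule nn_integral_mono)
    fix z assume z: "z \<in> space M"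
    show "ennreal a * (indicator (C \<inter> pre n E) z * ennreal (1 / jac n z)) \<le> indicator (C \<inter> pre n E) z"
    proof (cases "z \<in> C \<inter> pre n E")
      case in_set: True
      then have "a * (1 / jac n z) \<le> 1"
        using a[OF in_set] jac_pos[OF z, of n] by (simp add: field_simps)
      then show ?thesis
        using in_set True by (simp add: ennreal_mult' [symmetric])
    qed simp
  qed
  also have "\<dots> = ennreal (measure M (C \<inter> pre n E))"
    using S by (simp add: emeasure_eq_measure)
  finally show ?thesis
    by (simp add: ennreal_le_iff)
next
  case False
  then have "a * measure M E \<le> 0"
    by (simp add: mult_nonpos_nonneg)
  then show ?thesis
    using measure_nonneg order_trans by blast
qed

lemma cyl_in_space: "C \<in> cyl n \<Longrightarrow> z \<in> C \<Longrightarrow> z \<in> space M"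
  using cyl_subset_space by blast

lemma jac_le: "1 \<le> n \<Longrightarrow> C \<in> cyl n \<Longrightarrow> z \<in> C \<Longrightarrow> jac n z \<le> D * measure M C"
  using gibbs(1)[of n z] jac_pos[of z n] D by (simp add: cyl_in_space cyl_at_eq field_simps)

lemma jac_ge: "1 \<le> n \<Longrightarrow> C \<in> cyl n \<Longrightarrow> z \<in> C \<Longrightarrow> measure M C \<le> D * jac n z"
  using gibbs(2)[of n z] jac_pos[of z n] D by (simp add: cyl_in_space cyl_at_eq field_simps)

lemma cyl_pos:
  assumes "1 \<le> n" "C \<in> cyl n"
  shows "0 < measure M C"
proof -
  obtain z where z: "z \<in> C" using cyl_nonempty[OF assms(2)] by blast
  then have "0 < jac n z" using assms cyl_in_space jac_pos by blast
  then have "0 < D * measure M C" using jac_le[OF assms z] by linarith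
  then show ?thesis using D by (simp add: zero_less_mult_iff)
qed

text \<open>
  On \<open>C\<close> the function \<open>g\<^sub>n\<close> is at most \<open>D \<mu>(C)\<close>, so the law of \<open>T\<^sup>nz\<close> for \<open>z\<close> distributed
  on \<open>C\<close> has density at most \<open>D\<close>.
\<close>

lemma cyl_pre_upper:
  assumes "1 \<le> n" "C \<in> cyl n" "E \<in> sets M"
  shows "measure M (C \<inter> pre n E) \<le> D * measure M C * measure M E"
  using assms D by (intro measure_cyl_pre_le) (auto intro: jac_le)

text \<open>
  The density of the law of \<open>T\<^sup>nz\<close> is at least \<open>1 / D\<close> on \<open>T\<^sup>nC\<close>, which contains \<open>A\<close> as soon as
  it meets \<open>A\<close>.
\<close>

lemma cyl_pre_lower:
  assumes "1 \<le> n" "C \<in> cyl n" "E \<in> sets M" "A \<in> P" "A \<inter> (T ^^ n) ` C \<noteq> {}" "E \<subseteq> A"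
  shows "measure M C * measure M E \<le> D * measure M (C \<inter> pre n E)"
proof -
  have "E \<subseteq> (T ^^ n) ` C"
    using image_cyl assms by blast
  then have "measure M C / D * measure M E \<le> measure M (C \<inter> pre n E)"
    using assms D jac_ge[OF assms(1,2)] by (intro measure_cyl_pre_ge) (auto simp: field_simps)
  then show ?thesis using D by (simp add: field_simps)
qed

lemma separation_dist:
  assumes "1 \<le> r" "W \<in> cyl r" "y \<in> W" "z \<in> W"
  shows "cylinder_dist lam M T P y z \<le> lam ^ r"
proof -
  have "enat r \<le> separation_time M T P y z"
    unfolding separation_time_def using assms by (intro Sup_upper) auto
  then show ?thesis
    using lam by (auto simp: cylinder_dist_def split: enat.split intro!: power_decreasing)
qed

lemma jac_ratio:
  assumes "1 \<le> n" "C \<in> cyl n" "1 \<le> r" "W \<in> cyl r" "y \<in> C \<inter> pre n W" "z \<in> C \<inter> pre n W"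
  shows "jac n y \<le> (1 + D * lam ^ r) * jac n z"
proof -
  have "\<bar>jac n y / jac n z - 1\<bar> \<le> D * cylinder_dist lam M T P ((T ^^ n) y) ((T ^^ n) z)"
    using assms by (intro distortion) auto
  also have "\<dots> \<le> D * lam ^ r"
    using assms D by (intro mult_left_mono separation_dist[of r W]) auto
  finally have "jac n y / jac n z \<le> 1 + D * lam ^ r" by linarith
  then show ?thesis
    using jac_pos[of z n] assms by (simp add: field_simps)
qed

lemma image_contains_cyl:
  assumes C: "C \<in> cyl n" and W: "1 \<le> r" "W \<in> cyl r" "C \<inter> pre n W \<noteq> {}"
  shows "W \<subseteq> (T ^^ n) ` C"
proof -
  obtain w where w: "w \<in> C" "(T ^^ n) w \<in> W" using W(3) by blast
  have Tw: "(T ^^ n) w \<in> space M" using w(2) W(2) cyl_in_space by blast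
  have "W = cyl_at r ((T ^^ n) w)" using cyl_at_eq[OF W(2) w(2)] by simp
  then have "W \<subseteq> cyl_at 1 ((T ^^ n) w)"
    using cyl_at_antimono[OF Tw W(1)] by simp
  also have "\<dots> \<subseteq> (T ^^ n) ` C"
    using in_cyl_at[OF Tw] w(1) cyl_at_in[OF Tw, of 1]
    by (intro image_cyl[OF C]) (auto simp only: cyl_one)
  finally show ?thesis .
qed

text \<open>
  Two points of \<open>C\<close> with images in the same \<open>r\<close>-cylinder \<open>W\<close> have values of \<open>g\<^sub>n\<close> that differ at
  most by the factor \<open>1 + D \<lambda>\<^sup>r\<close>. Hence pulling back along \<open>C\<close> changes ratios of measures of
  subsets of \<open>W\<close> by at most this factor.
\<close>

lemma cyl_pre_ratio:
  assumes C: "1 \<le> n" "C \<in> cyl n" and W: "1 \<le> r" "W \<in> cyl r" "C \<inter> pre n W \<noteq> {}"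
    and E: "E \<in> sets M" "E \<subseteq> W" and F: "F \<in> sets M" "F \<subseteq> W"
  shows "measure M (C \<inter> pre n E) * measure M F \<le> (1 + D * lam ^ r) * (measure M (C \<inter> pre n F) * measure M E)"
proof (cases "measure M E = 0")
  case True
  then have "measure M (C \<inter> pre n E) \<le> 0"
    using cyl_pre_upper[OF C E(1)] by simp
  with True show ?thesis
    by (simp add: order.antisym[OF _ measure_nonneg])
next
  case False
  then have E0: "0 < measure M E" by (simp add: zero_less_measure_iff)
  let ?k = "1 + D * lam ^ r"
  have k: "0 < ?k" using D lam by (intro add_pos_nonneg) auto
  have F': "F \<subseteq> (T ^^ n) ` C" using image_contains_cyl[OF C(2) W] F(2) by blast
  have "measure M (C \<inter> pre n E) / (?k * measure M E) \<le> jac n z" if z: "z \<in> C \<inter> pre n F" for z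
  proof -
    have "0 < jac n z" using z C(2) cyl_in_space jac_pos by blast
    moreover have "jac n y \<le> ?k * jac n z" if "y \<in> C \<inter> pre n E" for y
      using that z E(2) F(2) by (intro jac_ratio[OF C W(1,2)]) auto
    ultimately have "measure M (C \<inter> pre n E) \<le> ?k * jac n z * measure M E"
      using k by (intro measure_cyl_pre_le[OF C(2) E(1)]) auto
    then show ?thesis
      using mult_pos_pos[OF k E0] by (simp only: pos_divide_le_eq mult_ac)
  qed
  from measure_cyl_pre_ge[OF C(2) F(1) F' this]
  have "measure M (C \<inter> pre n E) * measure M F \<le> measure M (C \<inter> pre n F) * (?k * measure M E)"
    using mult_pos_pos[OF k E0]
    by (simp only: times_divide_eq_left pos_divide_le_eq)
  then show ?thesis by (simp only: mult_ac)
qed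

section \<open>Unions of cylinders\<close>

definition saturated :: "nat \<Rightarrow> 'a set \<Rightarrow> bool" where
  "saturated n Q \<longleftrightarrow> Q \<subseteq> space M \<and> (\<forall>z\<in>Q. cyl_at n z \<subseteq> Q)"

lemma saturated_eq: "saturated n Q \<Longrightarrow> Q = \<Union>{C \<in> cyl n. C \<subseteq> Q}"
  unfolding saturated_def by (auto intro!: cyl_at_in in_cyl_at)

lemma saturated_sets: "saturated n Q \<Longrightarrow> Q \<in> sets M"
  by (subst saturated_eq, assumption, rule sets.countable_Union)
    (auto intro: cyl_sets countable_subset[OF _ countable_cyl[of n]])

lemma saturated_mono: "saturated n Q \<Longrightarrow> n \<le> k \<Longrightarrow> saturated k Q"
  unfolding saturated_def using cyl_at_antimono by blast

lemma saturated_cyl: "C \<in> cyl n \<Longrightarrow> saturated n C"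
  unfolding saturated_def using cyl_subset_space cyl_at_eq by blast

lemma saturated_space: "saturated n (space M)"
  unfolding saturated_def using cyl_at_in cyl_subset_space by blast

lemma saturated_Int: "saturated n Q \<Longrightarrow> saturated n R \<Longrightarrow> saturated n (Q \<inter> R)"
  unfolding saturated_def by blast

lemma saturated_Diff: "saturated n Q \<Longrightarrow> saturated n R \<Longrightarrow> saturated n (Q - R)"
  unfolding saturated_def
proof safe
  fix z y
  assume R: "R \<subseteq> space M" "\<forall>z\<in>R. cyl_at n z \<subseteq> R" and z: "z \<in> Q" "z \<notin> R" "Q \<subseteq> space M"
    and y: "y \<in> cyl_at n z" "y \<in> R"
  have zM: "z \<in> space M" using z by blast
  have "z \<in> cyl_at n y" unfolding cyl_at_same[OF zM y(1)] by (rule in_cyl_at[OF zM])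
  with R(2) y(2) z(2) show False by blast
qed auto

lemma saturated_pre: "saturated k Q \<Longrightarrow> saturated (n + k) (pre n Q)"
  unfolding saturated_def by (auto simp: cyl_at_add)

text \<open>
  Estimates on cylinders add up over unions of cylinders. The coefficients are arbitrary
  reals, so that with negative ones the lemma also yields lower bounds.
\<close>

lemma saturated_measure_le:
  assumes Q: "saturated n Q" and F: "F \<in> sets M" and G: "G \<in> sets M"
    and le: "\<And>C. C \<in> cyl n \<Longrightarrow> C \<subseteq> Q \<Longrightarrow> a * measure M (C \<inter> F) \<le> b * measure M (C \<inter> G)"
  shows "a * measure M (Q \<inter> F) \<le> b * measure M (Q \<inter> G)"
proof -
  define A where "A i = {z \<in> Q. to_nat_on (cyl n) (cyl_at n z) = i}" for i
  have QM: "Q \<subseteq> space M" using Q by (simp add: saturated_def)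
  have A: "A i = {} \<or> A i \<in> cyl n \<and> A i \<subseteq> Q" for i
  proof (cases "A i = {}")
    case False
    then obtain z where z: "z \<in> A i" by blast
    then have zM: "z \<in> space M" using QM by (auto simp: A_def)
    have eq: "A i = cyl_at n z"
    proof
      show "A i \<subseteq> cyl_at n z"
      proof
        fix y assume y: "y \<in> A i"
        then have yM: "y \<in> space M" using QM by (auto simp: A_def)
        have "to_nat_on (cyl n) (cyl_at n y) = to_nat_on (cyl n) (cyl_at n z)"
          using y z by (simp add: A_def)
        then have "cyl_at n y = cyl_at n z"
          using inj_onD[OF inj_on_to_nat_on[OF countable_cyl]] cyl_at_in yM zM by blast
        then show "y \<in> cyl_at n z" using in_cyl_at[OF yM, of n] by simp
      qed
      show "cyl_at n z \<subseteq> A i"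
      proof
        fix y assume y: "y \<in> cyl_at n z"
        have "z \<in> Q" using z by (simp add: A_def)
        then have "y \<in> Q" using Q y by (auto simp: saturated_def)
        then show "y \<in> A i" using z by (simp add: A_def cyl_at_same[OF zM y])
      qed
    qed
    with z Q cyl_at_in[OF zM] show ?thesis by (auto simp: A_def saturated_def)
  qed simp
  have sums: "(\<lambda>i. measure M (A i \<inter> E)) sums measure M (Q \<inter> E)" if E: "E \<in> sets M" for E
  proof -
    have "A i \<in> sets M" for i using A[of i] cyl_sets by auto
    then have "(\<lambda>i. measure M (A i \<inter> E)) sums measure M (\<Union>i. A i \<inter> E)"
      using E by (intro finite_measure_UNION) (auto simp: disjoint_family_on_def A_def)
    also have "(\<Union>i. A i \<inter> E) = Q \<inter> E" by (auto simp: A_def)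
    finally show ?thesis .
  qed
  have "a * measure M (A i \<inter> F) \<le> b * measure M (A i \<inter> G)" for i
    using A[of i] le[of "A i"] by auto
  then show ?thesis
    using sums_le[OF _ sums_mult[OF sums[OF F]] sums_mult[OF sums[OF G]]] by blast
qed

section \<open>Ergodicity\<close>

text \<open>
  The points that visit \<open>W\<close> infinitely often form a strictly invariant set. It is the decreasing
  limit of the sets \<open>S n\<close> of points that visit \<open>W\<close> after time \<open>n\<close>. These all have the same
  measure, which is at least \<open>\<mu>(W)\<close>, so ergodicity makes the limit, and a fortiori \<open>S 0\<close>, a set of
  full measure.
\<close>

lemma ergodic_connects:
  assumes A: "A \<in> sets M" "0 < measure M A" and W: "W \<in> sets M" "0 < measure M W"
  shows "\<exists>k\<ge>1. 0 < measure M (A \<inter> pre k W)"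
proof (rule ccontr)
  assume none: "\<not> ?thesis"
  define S where "S n = (\<Union>k. pre (Suc (n + k)) W)" for n
  have S_sets [measurable]: "S n \<in> sets M" for n
    unfolding S_def by (intro sets.countable_UN) (auto simp del: funpow.simps intro: pre_sets[OF W(1)])
  have pre_S: "pre 1 (S n) = S (Suc n)" for n
    unfolding S_def by (auto simp: funpow_swap1 measurable_space[OF T_measurable])
  have "S (Suc n) \<subseteq> S n" for n
    unfolding S_def
  proof safe
    fix z k assume "z \<in> space M" "(T ^^ Suc (Suc n + k)) z \<in> W"
    then show "z \<in> (\<Union>k. pre (Suc (n + k)) W)"
      by (auto intro!: exI[of _ "Suc k"])
  qed
  then have dec: "decseq S" by (rule decseq_SucI)
  let ?E = "\<Inter>n. S n"
  have "measure M (S (Suc n)) = measure M (S n)" for n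
    using measure_pre[OF S_sets[of n], of 1] by (simp only: pre_S)
  then have const: "measure M (S n) = measure M (S 0)" for n
    by (induction n) auto
  have "(\<lambda>n. measure M (S n)) \<longlonglongrightarrow> measure M ?E"
    by (rule finite_Lim_measure_decseq[OF _ dec]) auto
  moreover have "(\<lambda>n. measure M (S n)) = (\<lambda>n. measure M (S 0))"
    by (rule ext) (rule const)
  ultimately have E: "measure M ?E = measure M (S 0)"
    by (simp add: LIMSEQ_const_iff)
  have "T -` ?E \<inter> space M = (\<Inter>n. pre 1 (S n))"
    by auto
  also have "\<dots> = (\<Inter>n. S (Suc n))"
    by (simp only: pre_S)
  also have "\<dots> = ?E"
  proof
    show "(\<Inter>n. S (Suc n)) \<subseteq> ?E"
      using decseqD[OF dec] by (meson INT_greatest INT_lower UNIV_I le_SucI order_refl order_trans)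
  qed auto
  finally have "measure M ?E = 0 \<or> measure M ?E = 1"
    using ergodic by (auto simp: ergodic_def)
  moreover have "measure M W \<le> measure M (S 0)"
    unfolding measure_pre[OF W(1), of 1, symmetric]
    by (intro finite_measure_mono S_sets) (auto simp: S_def intro!: exI[of _ 0])
  ultimately have S1: "measure M (S 0) = 1"
    using W(2) E by linarith
  have "measure M (A \<inter> pre (Suc k) W) = 0" for k
    using none by (auto simp: not_less measure_le_0_iff)
  then have "A \<inter> pre (Suc k) W \<in> null_sets M" for k
    using A(1) pre_sets[OF W(1), of "Suc k"] by (auto simp: null_sets_def emeasure_eq_measure)
  then have "(\<Union>k. A \<inter> pre (Suc k) W) \<in> null_sets M"
    by (rule null_sets_UN)
  also have "(\<Union>k. A \<inter> pre (Suc k) W) = A \<inter> S 0"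
    by (auto simp: S_def)
  finally have "measure M (A \<inter> S 0) = 0"
    by (simp add: measure_eq_0_null_sets)
  moreover have "measure M (space M - S 0) = 0"
    using S1 by (simp add: prob_compl)
  moreover have "measure M A \<le> measure M (A \<inter> S 0) + measure M (space M - S 0)"
    using A(1) sets.sets_into_space[OF A(1)]
    by (intro order_trans[OF finite_measure_mono measure_Un_le]) auto
  ultimately show False using A(2) by linarith
qed

lemma finite_subpartition:
  assumes "c < 1"
  obtains F where "finite F" "F \<subseteq> P" "c < measure M (\<Union>F)"
proof -
  have "P \<noteq> {}" using P_cover not_empty by blast
  then have rng: "range (from_nat_into P) = P"
    using countable_P by (rule range_from_nat_into)
  let ?U = "\<lambda>n. \<Union>(from_nat_into P ` {..<n})"
  have inP: "from_nat_into P i \<in> P" for i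
    using \<open>P \<noteq> {}\<close> by (rule from_nat_into)
  have "(\<lambda>n. measure M (?U n)) \<longlonglongrightarrow> measure M (\<Union>n. ?U n)"
    using sets_P[OF inP] by (intro finite_Lim_measure_incseq) (auto simp: incseq_def intro!: bexI lessThan_iff[THEN iffD2])
  also have "(\<Union>n. ?U n) = space M"
  proof -
    have "(\<Union>n. ?U n) = \<Union>(range (from_nat_into P))" by blast
    then show ?thesis using rng partition_P by (simp add: partition_on_def)
  qed
  finally have "\<forall>\<^sub>F n in sequentially. c < measure M (?U n)"
    using assms by (intro order_tendstoD) (auto simp: prob_space)
  then obtain n where "c < measure M (?U n)"
    by (auto simp: eventually_sequentially)
  then show ?thesis
    using inP by (intro that[of "from_nat_into P ` {..<n}"]) auto
qed

text \<open>
  There are infinitely many cylinders \<open>C\<close>, but up to a constant factor the future of \<open>C\<close> depends only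
  on the elements of \<open>P\<close> that \<open>T\<^sup>nC\<close> contains. Finitely many elements of \<open>P\<close> that carry enough
  measure are enough to be met by every \<open>T\<^sup>nC\<close>, and each of them reaches \<open>W\<close>.
\<close>

lemma uniform_hitting:
  assumes W: "W \<in> sets M" "0 < measure M W"
  obtains K \<delta> where "0 < \<delta>"
    and "\<And>n C. 1 \<le> n \<Longrightarrow> C \<in> cyl n \<Longrightarrow> \<exists>k\<le>K. \<delta> * measure M C \<le> measure M (C \<inter> pre (n + k) W)"
proof -
  obtain F where F: "finite F" "F \<subseteq> P" "1 - 1 / D < measure M (\<Union>F)"
    using finite_subpartition[of "1 - 1 / D"] D by auto
  have UF: "\<Union>F \<in> sets M" using F sets_P by auto
  have "\<exists>k. 0 < measure M (A \<inter> pre k W)" if "A \<in> F" for A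
    using ergodic_connects[OF _ _ W] sets_P measure_P F(2) that by blast
  then obtain \<kappa> where \<kappa>: "\<And>A. A \<in> F \<Longrightarrow> 0 < measure M (A \<inter> pre (\<kappa> A) W)" by metis
  define \<delta> where "\<delta> = Min (insert 1 ((\<lambda>A. measure M (A \<inter> pre (\<kappa> A) W) / D) ` F))"
  define K where "K = Max (insert 0 (\<kappa> ` F))"
  have \<delta>: "0 < \<delta>" unfolding \<delta>_def using F(1) \<kappa> D by (subst Min_gr_iff) auto
  show ?thesis
  proof (rule that[OF \<delta>, of K])
    fix n C assume n: "1 \<le> n" and C: "C \<in> cyl n"
    note C0 = cyl_pos[OF n C]
    \<comment> \<open>By the upper distortion bound, \<open>C\<close> cannot be mapped entirely outside \<open>\<Union>F\<close>.\<close>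
    have "measure M (C \<inter> pre n (space M - \<Union>F)) \<le> D * measure M C * measure M (space M - \<Union>F)"
      using UF by (intro cyl_pre_upper n C) auto
    also have "\<dots> < D * measure M C * (1 / D)"
      using F(3) D C0 UF by (intro mult_strict_left_mono) (auto simp: prob_compl)
    also have "\<dots> = measure M C" using D by simp
    finally have "C \<inter> pre n (space M - \<Union>F) \<noteq> C" by auto
    then obtain A where A: "A \<in> F" "A \<inter> (T ^^ n) ` C \<noteq> {}"
      using cyl_in_space[OF C] funpow_in_space by blast
    let ?E = "A \<inter> pre (\<kappa> A) W"
    have E: "?E \<in> sets M" using A F(2) sets_P pre_sets[OF W(1)] by blast
    have "measure M C * measure M ?E \<le> D * measure M (C \<inter> pre n ?E)"
      using A F(2) by (intro cyl_pre_lower[OF n C E, of A]) auto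
    moreover have "\<delta> \<le> measure M ?E / D"
      unfolding \<delta>_def using A F(1) by (intro Min_le) auto
    then have "\<delta> * measure M C \<le> measure M ?E / D * measure M C"
      by (rule mult_right_mono) simp
    moreover have "measure M (C \<inter> pre n ?E) \<le> measure M (C \<inter> pre (n + \<kappa> A) W)"
      using pre_pre[of n "\<kappa> A" W] by (intro finite_measure_mono cyl_pre_sets[OF C W(1)]) auto
    ultimately have "D * (\<delta> * measure M C) \<le> D * measure M (C \<inter> pre (n + \<kappa> A) W)"
      (is "D * ?x \<le> D * ?z")
    proof -
      assume 1: "measure M C * measure M ?E \<le> D * measure M (C \<inter> pre n ?E)"
        and 2: "?x \<le> measure M ?E / D * measure M C"
        and 3: "measure M (C \<inter> pre n ?E) \<le> ?z"
      have "D * ?x \<le> measure M C * measure M ?E"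
        using mult_left_mono[OF 2, of D] D by (simp add: mult.commute)
      also note 1
      also have "D * measure M (C \<inter> pre n ?E) \<le> D * ?z"
        using 3 D by (intro mult_left_mono) auto
      finally show ?thesis .
    qed
    then have "\<delta> * measure M C \<le> measure M (C \<inter> pre (n + \<kappa> A) W)"
      using D by simp
    moreover have "\<kappa> A \<le> K" unfolding K_def using A F(1) by (intro Max_ge) auto
    ultimately show "\<exists>k\<le>K. \<delta> * measure M C \<le> measure M (C \<inter> pre (n + k) W)" by blast
  qed
qed

section \<open>Nearly invariant sets decouple from cylinders\<close>

lemma cyl_split:
  assumes "B \<in> cyl (m + r)" "W \<in> cyl r" "B \<subseteq> pre m W"
  obtains C where "C \<in> cyl m" "B = C \<inter> pre m W"
proof -
  obtain z where z: "z \<in> B" using cyl_nonempty[OF assms(1)] by blast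
  have zM: "z \<in> space M" by (rule cyl_in_space[OF assms(1) z])
  have "(T ^^ m) z \<in> W" using z assms(3) by blast
  then have "cyl_at r ((T ^^ m) z) = W" by (rule cyl_at_eq[OF assms(2)])
  moreover have "B = cyl_at (m + r) z" using cyl_at_eq[OF assms(1) z] by simp
  ultimately have "B = cyl_at m z \<inter> pre m W" by (simp add: cyl_at_add[OF zM])
  with cyl_at_in[OF zM] show ?thesis by (rule that)
qed

text \<open>
  If the last \<open>r\<close> symbols of \<open>B\<close> spell \<open>W\<close>, then conditioning \<open>T\<^sup>m\<^sup>+\<^sup>rz \<in> E\<close> on \<open>z \<in> B\<close> is
  almost the same as conditioning \<open>T\<^sup>rz \<in> E\<close> on \<open>z \<in> W\<close>, whatever the first \<open>m\<close> symbols are.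
\<close>

lemma forget_past:
  assumes m: "1 \<le> m" and r: "1 \<le> r" and W: "W \<in> cyl r" and B: "B \<in> cyl (m + r)" "B \<subseteq> pre m W"
    and E: "E \<in> sets M"
  shows "measure M (B \<inter> pre (m + r) E) * measure M W
      \<le> (1 + D * lam ^ r) * (measure M B * measure M (W \<inter> pre r E))"
    and "measure M B * measure M (W \<inter> pre r E)
      \<le> (1 + D * lam ^ r) * (measure M (B \<inter> pre (m + r) E) * measure M W)"
proof -
  obtain C where C: "C \<in> cyl m" "B = C \<inter> pre m W"
    by (rule cyl_split[OF B(1) W B(2)])
  have WE: "W \<inter> pre r E \<in> sets M" by (rule cyl_pre_sets[OF W E])
  have ne: "C \<inter> pre m W \<noteq> {}" using cyl_nonempty[OF B(1)] C(2) by simp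
  have eq: "B \<inter> pre (m + r) E = C \<inter> pre m (W \<inter> pre r E)"
    using cyl_subset_space[OF W] by (auto simp: C(2) funpow_add add.commute[of m r])
  show "measure M (B \<inter> pre (m + r) E) * measure M W
      \<le> (1 + D * lam ^ r) * (measure M B * measure M (W \<inter> pre r E))"
    unfolding eq unfolding C(2)
    by (rule cyl_pre_ratio[OF m C(1) r W ne WE _ cyl_sets[OF W]]) auto
  show "measure M B * measure M (W \<inter> pre r E)
      \<le> (1 + D * lam ^ r) * (measure M (B \<inter> pre (m + r) E) * measure M W)"
    unfolding eq unfolding C(2)
    by (rule cyl_pre_ratio[OF m C(1) r W ne cyl_sets[OF W] _ WE]) auto
qed

lemma measure_sym_diff:
  assumes "A \<in> sets M" "B \<in> sets M"
  shows "\<bar>measure M A - measure M B\<bar> \<le> measure M ((A - B) \<union> (B - A))"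
proof -
  have "measure M A \<le> measure M (B \<union> ((A - B) \<union> (B - A)))"
    "measure M B \<le> measure M (A \<union> ((A - B) \<union> (B - A)))"
    using assms by (auto intro!: finite_measure_mono)
  moreover have "measure M (B \<union> ((A - B) \<union> (B - A))) \<le> measure M B + measure M ((A - B) \<union> (B - A))"
    "measure M (A \<union> ((A - B) \<union> (B - A))) \<le> measure M A + measure M ((A - B) \<union> (B - A))"
    using assms by (auto intro!: measure_Un_le)
  ultimately show ?thesis by linarith
qed

lemma cyl_pre_shift:
  assumes n: "1 \<le> n" and C: "C \<in> cyl n" and E: "E \<in> sets M"
    and d: "measure M ((E - pre k E) \<union> (pre k E - E)) \<le> d"
  shows "\<bar>measure M (C \<inter> pre n E) - measure M (C \<inter> pre (n + k) E)\<bar> \<le> D * d * measure M C"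
proof -
  let ?S = "(E - pre k E) \<union> (pre k E - E)"
  have S: "?S \<in> sets M" using E pre_sets by auto
  have "\<bar>measure M (C \<inter> pre n E) - measure M (C \<inter> pre (n + k) E)\<bar>
      \<le> measure M ((C \<inter> pre n E - C \<inter> pre (n + k) E) \<union> (C \<inter> pre (n + k) E - C \<inter> pre n E))"
    by (intro measure_sym_diff cyl_pre_sets[OF C E])
  also have "\<dots> \<le> measure M (C \<inter> pre n ?S)"
    using pre_pre[of n k E] by (intro finite_measure_mono cyl_pre_sets[OF C S]) auto
  also have "\<dots> \<le> D * measure M C * measure M ?S"
    by (rule cyl_pre_upper[OF n C S])
  also have "\<dots> \<le> D * measure M C * d"
    using d D by (intro mult_left_mono) auto
  finally show ?thesis by (simp add: mult_ac)
qed

text \<open>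
  Consider \<open>v(n, C) = \<mu>(T\<^sup>-\<^sup>nE | C)\<close> over all cylinders of all positive orders. By near invariance of
  \<open>E\<close> this is, up to \<open>D d\<close>, the average of \<open>v\<close> over the sub-cylinders of order \<open>n + k + r\<close>, and a
  proportion of at least \<open>\<delta>\<close> of these, by measure, end with the symbols of \<open>W\<close>. The sign \<open>\<sigma>\<close>
  gives the bounds of \<open>v\<close> from above and from below in one argument. The pair \<open>(n, C)\<close> is
  needed because the same set can be a cylinder of several orders.
\<close>

lemma maximum_principle:
  assumes W: "W \<in> cyl r" and \<delta>: "0 < \<delta>"
    and hit: "\<And>n C. 1 \<le> n \<Longrightarrow> C \<in> cyl n \<Longrightarrow> \<exists>k\<le>K. \<delta> * measure M C \<le> measure M (C \<inter> pre (n + k) W)"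
    and E: "E \<in> sets M"
    and d: "\<And>k. k \<le> K + r \<Longrightarrow> measure M ((E - pre k E) \<union> (pre k E - E)) \<le> d"
    and \<sigma>: "\<bar>\<sigma>\<bar> = 1"
    and good: "\<And>m B. 1 \<le> m \<Longrightarrow> B \<in> cyl (m + r) \<Longrightarrow> B \<subseteq> pre m W \<Longrightarrow>
        \<sigma> * measure M (B \<inter> pre (m + r) E) \<le> a * measure M B"
    and n: "1 \<le> n" and C: "C \<in> cyl n"
  shows "\<sigma> * measure M (C \<inter> pre n E) \<le> (a + D * d / \<delta>) * measure M C"
proof -
  define f where "f = (\<lambda>(n, C). \<sigma> * measure M (C \<inter> pre n E) / measure M C)"
  define S where "S = {(n, C). 1 \<le> n \<and> C \<in> cyl n}"
  have f_le: "f (n, C) \<le> c \<longleftrightarrow> \<sigma> * measure M (C \<inter> pre n E) \<le> c * measure M C"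
    if "1 \<le> n" "C \<in> cyl n" for n C c
    using cyl_pos[OF that] by (simp add: f_def pos_divide_le_eq)
  have "0 \<le> d" using d[of 0] measure_nonneg order_trans by blast
  have "f (n, C) \<le> a + D * d / \<delta>"
  proof (rule sup_contraction[of S f 1])
    show "f s \<le> 1" if s: "s \<in> S" for s
    proof -
      obtain n C where s: "s = (n, C)" "1 \<le> n" "C \<in> cyl n" using s by (auto simp: S_def)
      have "\<sigma> * measure M (C \<inter> pre n E) \<le> \<bar>\<sigma>\<bar> * measure M (C \<inter> pre n E)"
        by (intro mult_right_mono) auto
      also have "\<dots> \<le> 1 * measure M C"
        using \<sigma> cyl_sets[OF s(3)] by (auto intro!: finite_measure_mono)
      finally show ?thesis using f_le[OF s(2,3)] s(1) by blast
    qed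
    show "0 < \<delta>" by (rule \<delta>)
    show "0 \<le> D * d" using D \<open>0 \<le> d\<close> by simp
    show "(n, C) \<in> S" using n C by (simp add: S_def)
    fix c s assume s: "s \<in> S" and ac: "a \<le> c" and le: "\<And>t. t \<in> S \<Longrightarrow> f t \<le> c"
    obtain n C where nC: "s = (n, C)" "1 \<le> n" "C \<in> cyl n" using s by (auto simp: S_def)
    obtain k where k: "k \<le> K" "\<delta> * measure M C \<le> measure M (C \<inter> pre (n + k) W)"
      using hit[OF nC(2,3)] by blast
    let ?N = "n + k + r" and ?Q = "C \<inter> pre (n + k) W"
    have EN: "pre ?N E \<in> sets M" by (rule pre_sets[OF E])
    have satC: "saturated ?N C"
      by (rule saturated_mono[OF saturated_cyl[OF nC(3)]]) simp
    have satQ: "saturated ?N ?Q"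
      by (intro saturated_Int satC saturated_pre saturated_cyl W)
    have 1: "\<sigma> * measure M (?Q \<inter> pre ?N E) \<le> a * measure M (?Q \<inter> space M)"
    proof (rule saturated_measure_le[OF satQ EN sets.top])
      fix B assume B: "B \<in> cyl ?N" "B \<subseteq> ?Q"
      have "\<sigma> * measure M (B \<inter> pre ?N E) \<le> a * measure M B"
        using B nC(2) by (intro good) auto
      then show "\<sigma> * measure M (B \<inter> pre ?N E) \<le> a * measure M (B \<inter> space M)"
        using cyl_subset_space[OF B(1)] by (simp add: Int_absorb2)
    qed
    have 2: "\<sigma> * measure M ((C - ?Q) \<inter> pre ?N E) \<le> c * measure M ((C - ?Q) \<inter> space M)"
    proof (rule saturated_measure_le[OF saturated_Diff[OF satC satQ] EN sets.top])
      fix B assume B: "B \<in> cyl ?N" "B \<subseteq> C - ?Q"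
      have "1 \<le> ?N" using nC(2) by simp
      then have "f (?N, B) \<le> c" using B by (intro le) (simp add: S_def)
      then show "\<sigma> * measure M (B \<inter> pre ?N E) \<le> c * measure M (B \<inter> space M)"
        using f_le[OF \<open>1 \<le> ?N\<close> B(1)] cyl_subset_space[OF B(1)] by (simp add: Int_absorb2)
    qed
    have Cs: "C \<in> sets M" and Qs: "?Q \<in> sets M"
      using cyl_sets[OF nC(3)] saturated_sets[OF satQ] by auto
    have split: "measure M (C \<inter> G) = measure M (?Q \<inter> G) + measure M ((C - ?Q) \<inter> G)" if "G \<in> sets M" for G
      using Cs Qs that by (subst finite_measure_Union[symmetric]) (auto intro!: arg_cong[where f = "measure M"])
    have "C \<inter> space M = C" using cyl_subset_space[OF nC(3)] by blast
    then have mC: "measure M C = measure M (?Q \<inter> space M) + measure M ((C - ?Q) \<inter> space M)"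
      using split[OF sets.top] by simp
    have Qsp: "?Q \<inter> space M = ?Q" by blast
    have "\<sigma> * measure M (C \<inter> pre ?N E)
        = \<sigma> * measure M (?Q \<inter> pre ?N E) + \<sigma> * measure M ((C - ?Q) \<inter> pre ?N E)"
      unfolding split[OF EN] by (rule distrib_left)
    also have "\<dots> \<le> c * measure M C - (c - a) * measure M ?Q"
      using 1 2 mC unfolding Qsp by (simp add: algebra_simps)
    also have "\<dots> \<le> c * measure M C - (c - a) * (\<delta> * measure M C)"
      using k(2) ac by (intro diff_left_mono mult_left_mono) auto
    finally have "\<sigma> * measure M (C \<inter> pre ?N E) \<le> (c - \<delta> * (c - a)) * measure M C"
      by (simp add: algebra_simps)
    moreover have "\<sigma> * (measure M (C \<inter> pre n E) - measure M (C \<inter> pre ?N E)) \<le> D * d * measure M C"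
    proof -
      have 3: "\<bar>measure M (C \<inter> pre n E) - measure M (C \<inter> pre (n + (k + r)) E)\<bar> \<le> D * d * measure M C"
        using k(1) by (intro cyl_pre_shift nC E d) auto
      have "\<sigma> * y \<le> \<bar>y\<bar>" for y
        using \<sigma> abs_mult[of \<sigma> y] abs_ge_self[of "\<sigma> * y"] by simp
      from order_trans[OF this 3] show ?thesis by (simp only: add.assoc)
    qed
    ultimately have "\<sigma> * measure M (C \<inter> pre n E) \<le> (c - \<delta> * (c - a) + D * d) * measure M C"
      by (simp add: algebra_simps)
    then show "f s \<le> c - \<delta> * (c - a) + D * d"
      using f_le[OF nC(2,3)] nC(1) by blast
  qed
  then show ?thesis using f_le[OF n C] by blast
qed

text \<open>
  The maximum principle, applied with both signs, pins \<open>v(n, C)\<close> to the value \<open>v\<close> at \<open>W\<close>. The mean of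
  \<open>v(1, C)\<close> over the cylinders of order 1 is \<open>\<mu>(E)\<close> by invariance, so \<open>v\<close> itself is close
  to \<open>\<mu>(E)\<close>. First \<open>r\<close>, and with it \<open>W\<close>, is chosen to make the distortion small; this fixes
  \<open>K\<close> and \<open>\<delta>\<close>, and only then is \<open>\<eta>\<close> chosen relative to \<open>\<delta>\<close>.
\<close>

lemma nearly_invariant_decouples:
  assumes \<epsilon>: "0 < \<epsilon>"
  obtains K \<eta> where "0 < \<eta>"
    and "\<And>E n C. E \<in> sets M \<Longrightarrow>
      (\<And>k. k \<le> K \<Longrightarrow> measure M ((E - pre k E) \<union> (pre k E - E)) \<le> \<eta> * measure M E) \<Longrightarrow>
      1 \<le> n \<Longrightarrow> C \<in> cyl n \<Longrightarrow>
      \<bar>measure M (C \<inter> pre n E) - measure M C * measure M E\<bar> \<le> \<epsilon> * (measure M C * measure M E)"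
proof -
  \<comment> \<open>Both relative errors, from distortion and from near invariance, are at most \<open>x\<close>. They enter in
    the combinations \<open>(1 + x)\<^sup>3 + x\<close> and \<open>(1 - x)\<^sup>3 - x\<close>, which stay within \<open>8 x\<close> of 1.\<close>
  define x where "x = min \<epsilon> 1 / 8"
  have x: "0 < x" "x \<le> 1 / 8" "8 * x \<le> \<epsilon>" using \<epsilon> by (auto simp: x_def)
  have "(\<lambda>r. D * lam ^ r) \<longlonglongrightarrow> D * 0"
    using lam by (intro tendsto_mult tendsto_const LIMSEQ_power_zero) auto
  then have "\<forall>\<^sub>F r in sequentially. D * lam ^ r < x"
    using x(1) by (intro order_tendstoD) auto
  then obtain r where r: "1 \<le> r" "D * lam ^ r < x"
    using eventually_happens'[OF sequentially_bot eventually_conj[OF eventually_ge_at_top]] by blast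
  define \<kappa> where "\<kappa> = D * lam ^ r"
  have \<kappa>: "0 \<le> \<kappa>" "\<kappa> < x" using r(2) D lam by (auto simp: \<kappa>_def)
  obtain z where z: "z \<in> space M" using not_empty by blast
  define W where "W = cyl_at r z"
  have W: "W \<in> cyl r" unfolding W_def by (rule cyl_at_in[OF z])
  have W0: "0 < measure M W" by (rule cyl_pos[OF r(1) W])
  obtain \<delta> K where \<delta>: "0 < \<delta>"
    and hit: "\<And>n C. 1 \<le> n \<Longrightarrow> C \<in> cyl n \<Longrightarrow> \<exists>k\<le>K. \<delta> * measure M C \<le> measure M (C \<inter> pre (n + k) W)"
    by (rule uniform_hitting[OF cyl_sets[OF W] W0]) (rule that)
  define \<eta> where "\<eta> = x * \<delta> / D"
  have \<eta>: "0 < \<eta>" using x(1) \<delta> D by (simp add: \<eta>_def)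
  show ?thesis
  proof (rule that[OF \<eta>, of "K + r"])
    fix E n C
    assume E: "E \<in> sets M"
      and d: "\<And>k. k \<le> K + r \<Longrightarrow> measure M ((E - pre k E) \<union> (pre k E - E)) \<le> \<eta> * measure M E"
      and n: "1 \<le> n" and C: "C \<in> cyl n"
    define p where "p = measure M E"
    define v where "v = measure M (W \<inter> pre r E) / measure M W"
    have p0: "0 \<le> p" and v0: "0 \<le> v" by (auto simp: p_def v_def)
    have err: "D * (\<eta> * p) / \<delta> = x * p" using D \<delta> by (simp add: \<eta>_def)
    have upper: "measure M (C \<inter> pre n E) \<le> ((1 + \<kappa>) * v + x * p) * measure M C"
      if "1 \<le> n" "C \<in> cyl n" for n C
    proof -
      have "1 * measure M (C \<inter> pre n E) \<le> ((1 + \<kappa>) * v + D * (\<eta> * p) / \<delta>) * measure M C"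
      proof (rule maximum_principle[OF W \<delta> hit E _ _ _ that])
        show "1 * measure M (B \<inter> pre (m + r) E) \<le> (1 + \<kappa>) * v * measure M B"
          if "1 \<le> m" "B \<in> cyl (m + r)" "B \<subseteq> pre m W" for m B
          using forget_past(1)[OF that(1) r(1) W that(2,3) E] W0 by (simp add: v_def \<kappa>_def field_simps)
      qed (use d in \<open>auto simp: p_def\<close>)
      then show ?thesis by (simp add: err)
    qed
    have lower: "(v / (1 + \<kappa>) - x * p) * measure M C \<le> measure M (C \<inter> pre n E)"
      if "1 \<le> n" "C \<in> cyl n" for n C
    proof -
      have "- 1 * measure M (C \<inter> pre n E) \<le> (- (v / (1 + \<kappa>)) + D * (\<eta> * p) / \<delta>) * measure M C"
      proof (rule maximum_principle[OF W \<delta> hit E _ _ _ that])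
        show "- 1 * measure M (B \<inter> pre (m + r) E) \<le> - (v / (1 + \<kappa>)) * measure M B"
          if "1 \<le> m" "B \<in> cyl (m + r)" "B \<subseteq> pre m W" for m B
        proof -
          have "measure M B * measure M (W \<inter> pre r E) \<le> (1 + \<kappa>) * (measure M (B \<inter> pre (m + r) E) * measure M W)"
            using forget_past(2)[OF that(1) r(1) W that(2,3) E] by (simp add: \<kappa>_def)
          then have "measure M B * v \<le> (1 + \<kappa>) * measure M (B \<inter> pre (m + r) E)"
            using W0 by (simp add: v_def pos_divide_le_eq mult_ac)
          then show ?thesis using \<kappa>(1) by (simp add: pos_divide_le_eq mult_ac)
        qed
      qed (use d in \<open>auto simp: p_def\<close>)
      then show ?thesis by (simp add: err algebra_simps)
    qed
    have p1: "measure M (space M \<inter> pre 1 E) = p"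
      using measure_pre[OF E, of 1] by (simp add: p_def Int_absorb1)
    have Int_sp: "B \<inter> space M = B" if "B \<in> cyl 1" for B
      using cyl_subset_space[OF that] by (rule Int_absorb2)
    have "1 * measure M (space M \<inter> pre 1 E) \<le> ((1 + \<kappa>) * v + x * p) * measure M (space M \<inter> space M)"
    proof (rule saturated_measure_le[OF saturated_space[of 1] pre_sets[OF E] sets.top])
      fix B assume "B \<in> cyl 1"
      from upper[OF order_refl this]
      show "1 * measure M (B \<inter> pre 1 E) \<le> ((1 + \<kappa>) * v + x * p) * measure M (B \<inter> space M)"
        by (simp only: Int_sp[OF \<open>B \<in> cyl 1\<close>] mult_1)
    qed
    then have 1: "p \<le> (1 + \<kappa>) * v + x * p"
      by (simp only: p1 mult_1 Int_absorb prob_space mult_1_right)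
    have "(v / (1 + \<kappa>) - x * p) * measure M (space M \<inter> space M) \<le> 1 * measure M (space M \<inter> pre 1 E)"
    proof (rule saturated_measure_le[OF saturated_space[of 1] sets.top pre_sets[OF E]])
      fix B assume "B \<in> cyl 1"
      from lower[OF order_refl this]
      show "(v / (1 + \<kappa>) - x * p) * measure M (B \<inter> space M) \<le> 1 * measure M (B \<inter> pre 1 E)"
        by (simp only: Int_sp[OF \<open>B \<in> cyl 1\<close>] mult_1)
    qed
    then have 2: "v / (1 + \<kappa>) - x * p \<le> p"
      by (simp only: p1 mult_1 Int_absorb prob_space mult_1_right)
    have "(1 + \<kappa>) * v + x * p \<le> (1 + \<epsilon>) * p"
    proof -
      have "v \<le> (1 + \<kappa>) * (1 + x) * p" using 2 \<kappa> by (simp add: field_simps)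
      also have "\<dots> \<le> (1 + x) * (1 + x) * p"
        using \<kappa> x p0 by (intro mult_right_mono) auto
      finally have "(1 + \<kappa>) * v \<le> (1 + x) * ((1 + x) * (1 + x) * p)"
        using \<kappa> v0 x by (intro mult_mono) auto
      moreover have "(1 + x) * ((1 + x) * (1 + x)) + x \<le> 1 + 8 * x"
      proof -
        have "x * x \<le> x * 1" "x * x * x \<le> x * 1" using x mult_mono[of x 1 x 1] by (auto simp: mult.assoc intro!: mult_left_mono)
        then show ?thesis by (simp add: algebra_simps)
      qed
      then have "((1 + x) * ((1 + x) * (1 + x)) + x) * p \<le> (1 + \<epsilon>) * p"
        using x p0 by (intro mult_right_mono) auto
      ultimately show ?thesis by (simp add: algebra_simps)
    qed
    then have U: "((1 + \<kappa>) * v + x * p) * measure M C \<le> (1 + \<epsilon>) * p * measure M C"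
      by (rule mult_right_mono) simp
    have "(1 - \<epsilon>) * p \<le> v / (1 + \<kappa>) - x * p"
    proof -
      have "(1 - x) * p \<le> (1 + x) * v" using 1 mult_right_mono[of "1 + \<kappa>" "1 + x" v] \<kappa> v0 by (simp add: algebra_simps)
      then have "(1 - x) * ((1 - x) * p) \<le> (1 - x) * ((1 + x) * v)"
        using x by (intro mult_left_mono) auto
      also have "\<dots> = (1 - x * x) * v" by (simp add: algebra_simps)
      also have "\<dots> \<le> 1 * v" using v0 by (intro mult_right_mono) auto
      finally have "(1 - x) * ((1 - x) * ((1 - x) * p)) \<le> (1 - x) * v"
        using x by (intro mult_left_mono) auto
      also have "(1 - x) * v \<le> v / (1 + \<kappa>)"
      proof -
        have "(1 - x) * (1 + \<kappa>) \<le> (1 - x) * (1 + x)" using \<kappa> x by (intro mult_left_mono) auto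
        also have "\<dots> \<le> 1" by (simp add: algebra_simps)
        finally have "(1 - x) * (1 + \<kappa>) * v \<le> 1 * v" using v0 by (rule mult_right_mono)
        then show ?thesis using \<kappa> by (simp add: pos_le_divide_eq mult_ac)
      qed
      finally have "(1 - x) * ((1 - x) * (1 - x)) * p \<le> v / (1 + \<kappa>)" by (simp add: mult.assoc)
      moreover have "1 - \<epsilon> \<le> (1 - x) * ((1 - x) * (1 - x)) - x"
      proof -
        have "x * x * x \<le> 1 * x" using x mult_mono[of x 1 x 1] by (intro mult_right_mono) auto
        moreover have "(1 - x) * ((1 - x) * (1 - x)) = 1 - 3 * x + 3 * (x * x) - x * x * x"
          by (simp add: algebra_simps)
        ultimately show ?thesis using x zero_le_square[of x] by linarith
      qed
      then have "(1 - \<epsilon>) * p \<le> ((1 - x) * ((1 - x) * (1 - x)) - x) * p"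
        using p0 by (rule mult_right_mono)
      ultimately show ?thesis by (simp add: algebra_simps)
    qed
    then have L: "(1 - \<epsilon>) * p * measure M C \<le> (v / (1 + \<kappa>) - x * p) * measure M C"
      by (rule mult_right_mono) simp
    show "\<bar>measure M (C \<inter> pre n E) - measure M C * measure M E\<bar> \<le> \<epsilon> * (measure M C * measure M E)"
      using order_trans[OF upper[OF n C] U] order_trans[OF L lower[OF n C]]
      by (simp add: abs_le_iff p_def algebra_simps)
  qed
qed

section \<open>Survivors\<close>

definition surv :: "'a set \<Rightarrow> nat \<Rightarrow> 'a set" where
  "surv U s = {z \<in> space M. \<forall>j<s. (T ^^ j) z \<notin> U}"

lemma surv_sets: "U \<in> sets M \<Longrightarrow> surv U s \<in> sets M"
proof -
  assume U: "U \<in> sets M"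
  have "surv U s = space M - (\<Union>j\<in>{..<s}. pre j U)"
    by (auto simp: surv_def)
  then show ?thesis
    by (simp only:) (intro sets.Diff sets.top sets.finite_UN finite_lessThan pre_sets[OF U])
qed

lemma surv_0: "surv U 0 = space M"
  by (simp add: surv_def)

lemma surv_antimono: "s \<le> t \<Longrightarrow> surv U t \<subseteq> surv U s"
  by (auto simp: surv_def)

lemma surv_shift: "k + s \<le> t \<Longrightarrow> surv U t \<subseteq> pre k (surv U s)"
proof
  fix z assume "k + s \<le> t" and z: "z \<in> surv U t"
  then have "(T ^^ j) ((T ^^ k) z) \<notin> U" if "j < s" for j
    using that funpow_add[of j k T] by (auto simp: surv_def dest: spec[of _ "j + k"])
  with z show "z \<in> pre k (surv U s)" by (simp add: surv_def funpow_in_space)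
qed

lemma pre_surv_shift: "i \<le> k \<Longrightarrow> k + s \<le> i + t \<Longrightarrow> pre i (surv U t) \<subseteq> pre k (surv U s)"
proof -
  assume ik: "i \<le> k" "k + s \<le> i + t"
  have "pre i (surv U t) \<subseteq> pre i (pre (k - i) (surv U s))"
    using ik by (intro pre_mono surv_shift) auto
  also have "\<dots> = pre k (surv U s)" using ik by (simp only: pre_pre le_add_diff_inverse)
  finally show ?thesis .
qed

text \<open>Visits to the \<open>N\<close>-cylinder \<open>U\<close> before time \<open>s\<close> are decided by the first \<open>s + N\<close> symbols.\<close>

lemma surv_saturated:
  assumes "U \<in> cyl N"
  shows "saturated (s + N) (surv U s)"
  unfolding saturated_def
proof (intro conjI ballI subsetI)
  show "z \<in> space M" if "z \<in> surv U s" for z using that by (simp add: surv_def)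
  fix z y assume z: "z \<in> surv U s" and y: "y \<in> cyl_at (s + N) z"
  have zM: "z \<in> space M" using z by (simp add: surv_def)
  have yM: "y \<in> space M" using y cyl_in_space[OF cyl_at_in[OF zM]] by blast
  have "(T ^^ j) y \<notin> U" if j: "j < s" for j
  proof
    assume Uy: "(T ^^ j) y \<in> U"
    have "y \<in> cyl_at (j + N) z" using y cyl_at_antimono[OF zM, of "j + N" "s + N"] j by auto
    then have "(T ^^ j) y \<in> cyl_at N ((T ^^ j) z)" by (simp add: cyl_at_add[OF zM])
    then have "cyl_at N ((T ^^ j) z) = U"
      using cyl_disjoint[OF cyl_at_in[OF funpow_in_space[OF zM]] assms] Uy by blast
    then have "(T ^^ j) z \<in> U" using in_cyl_at[OF funpow_in_space[OF zM], of j N] by blast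
    with z j show False by (simp add: surv_def)
  qed
  then show "y \<in> surv U s" using yM by (simp add: surv_def)
qed

text \<open>
  By invariance \<open>\<mu>(F\<^sub>s) = \<mu>(T\<^sup>-\<^sup>1F\<^sub>s)\<close>, and a point of \<open>T\<^sup>-\<^sup>1F\<^sub>s\<close> is outside \<open>F\<^sub>s\<^sub>+\<^sub>1\<close>
  only if it lies in \<open>U\<close> at time 0.
\<close>

lemma surv_Suc_diff:
  assumes U: "U \<in> sets M"
  shows "measure M (surv U s) - measure M (surv U (Suc s)) = measure M (U \<inter> pre 1 (surv U s))"
proof -
  have "surv U (Suc s) = pre 1 (surv U s) - U"
    by (auto simp: surv_def funpow_swap1 less_Suc_eq_0_disj measurable_space[OF T_measurable])
  also have "\<dots> = pre 1 (surv U s) - U \<inter> pre 1 (surv U s)" by blast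
  finally have "measure M (surv U (Suc s)) = measure M (pre 1 (surv U s)) - measure M (U \<inter> pre 1 (surv U s))"
    using U pre_sets[OF surv_sets[OF U], of 1 s] by (simp only: finite_measure_Diff sets.Int Int_lower2)
  then show ?thesis by (simp only: measure_pre[OF surv_sets[OF U]])
qed

text \<open>
  The loss in one step is at most \<open>\<mu>(U \<inter> T\<^sup>-\<^sup>NF\<^sub>s\<^sub>-\<^sub>N) \<le> D \<mu>(U) p\<^sub>s\<^sub>-\<^sub>N\<close>. This is a bound
  in terms of an earlier value; the induction hypothesis gives \<open>p\<^sub>s\<^sub>-\<^sub>N \<le> 2 p\<^sub>s\<close>, because
  over \<open>N\<close> steps the factors \<open>1 - 2 D \<mu>(U)\<close> multiply to at least \<open>1 / 2\<close>.
\<close>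

lemma surv_decreases_slowly:
  assumes N: "1 \<le> N" and U: "U \<in> cyl N" and small: "4 * D * real N * measure M U \<le> 1"
  shows "0 < measure M (surv U s)"
    and "(1 - 2 * D * measure M U * real k) * measure M (surv U s) \<le> measure M (surv U (s + k))"
proof -
  define a where "a = 2 * D * measure M U"
  define p where "p s = measure M (surv U s)" for s
  note UM = cyl_sets[OF U]
  have a0: "0 \<le> a" using D by (simp add: a_def)
  have Na: "real N * a \<le> 1 / 2" using small by (simp add: a_def mult_ac)
  have a: "a \<le> 1 / 2" using mult_right_mono[of 1 "real N" a] N a0 Na by simp
  have p0: "0 \<le> p s" for s by (simp add: p_def)
  have pow: "(1 - a) ^ j * p t \<le> p (t + j)" if "\<And>i. i < j \<Longrightarrow> (1 - a) * p (t + i) \<le> p (Suc (t + i))" for j t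
    using that
  proof (induction j)
    case (Suc j)
    have "(1 - a) ^ Suc j * p t = (1 - a) * ((1 - a) ^ j * p t)" by simp
    also have "\<dots> \<le> (1 - a) * p (t + j)" using Suc a by (intro mult_left_mono Suc.IH) auto
    also have "\<dots> \<le> p (Suc (t + j))" by (rule Suc.prems) simp
    finally show ?case by simp
  qed simp
  have bern: "1 - real j * a \<le> (1 - a) ^ j" for j
    using Bernoulli_inequality[of "- a" j] a by simp
  have step: "(1 - a) * p s \<le> p (Suc s)" for s
  proof (induction s rule: less_induct)
    case (less s)
    define j where "j = min N s"
    have sj: "s - j = s - N" "s - j + j = s" by (auto simp: j_def)
    have "(1 - a) ^ j * p (s - j) \<le> p (s - j + j)"
      by (rule pow, rule less.IH) (use sj(2) in linarith)
    moreover have "real j * a \<le> real N * a" using a0 by (intro mult_right_mono) (auto simp: j_def)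
    then have "1 / 2 \<le> (1 - a) ^ j" using bern[of j] Na by linarith
    then have "1 / 2 * p (s - j) \<le> (1 - a) ^ j * p (s - j)" by (intro mult_right_mono p0)
    ultimately have "p (s - N) \<le> 2 * p s" using sj by simp
    have "p s - p (Suc s) = measure M (U \<inter> pre 1 (surv U s))"
      unfolding p_def by (rule surv_Suc_diff[OF UM])
    also have "\<dots> \<le> measure M (U \<inter> pre N (surv U (s - N)))"
    proof (rule finite_measure_mono)
      show "U \<inter> pre 1 (surv U s) \<subseteq> U \<inter> pre N (surv U (s - N))"
      proof (cases "N \<le> s")
        case True
        then show ?thesis using pre_surv_shift[of 1 N "s - N" s U] N by auto
      next
        case False
        then show ?thesis by (auto simp: surv_0 funpow_in_space)
      qed
    qed (rule cyl_pre_sets[OF U surv_sets[OF UM]])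
    also have "\<dots> \<le> D * measure M U * p (s - N)"
      unfolding p_def by (rule cyl_pre_upper[OF N U surv_sets[OF UM]])
    also have "\<dots> \<le> D * measure M U * (2 * p s)"
      using D \<open>p (s - N) \<le> 2 * p s\<close> by (intro mult_left_mono) auto
    also have "\<dots> = a * p s" by (simp add: a_def)
    finally show ?case by (simp add: algebra_simps)
  qed
  have "(1 - a) ^ s * p 0 \<le> p (0 + s)" by (rule pow) (rule step)
  moreover have "p 0 = 1" by (simp add: p_def surv_0 prob_space)
  ultimately have "(1 - a) ^ s \<le> p s" by simp
  moreover have "0 < (1 - a) ^ s" using a by simp
  ultimately show "0 < measure M (surv U s)" unfolding p_def by linarith
  have "(1 - real k * a) * p s \<le> (1 - a) ^ k * p s" by (intro mult_right_mono bern p0)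
  also have "\<dots> \<le> p (s + k)" by (rule pow) (rule step)
  finally show "(1 - 2 * D * measure M U * real k) * measure M (surv U s) \<le> measure M (surv U (s + k))"
    by (simp add: a_def p_def mult_ac)
qed

text \<open>
  Both \<open>F\<^sub>s\<close> and \<open>T\<^sup>-\<^sup>kF\<^sub>s\<close> contain \<open>F\<^sub>s\<^sub>+\<^sub>k\<close>, and both have measure \<open>p\<^sub>s\<close>.
\<close>

lemma surv_nearly_invariant:
  assumes N: "1 \<le> N" and U: "U \<in> cyl N" and small: "4 * D * real N * measure M U \<le> 1"
  shows "measure M ((surv U s - pre k (surv U s)) \<union> (pre k (surv U s) - surv U s))
    \<le> 4 * D * real k * measure M U * measure M (surv U s)"
proof -
  let ?E = "surv U s" and ?F = "surv U (s + k)"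
  note E = surv_sets[OF cyl_sets[OF U], of s] and F = surv_sets[OF cyl_sets[OF U], of "s + k"]
  have sub: "?F \<subseteq> ?E" "?F \<subseteq> pre k ?E"
    by (rule surv_antimono, simp) (rule surv_shift, simp)
  have "measure M ((?E - pre k ?E) \<union> (pre k ?E - ?E)) \<le> measure M ((?E - ?F) \<union> (pre k ?E - ?F))"
    using sub E F pre_sets[OF E, of k] by (intro finite_measure_mono) auto
  also have "\<dots> \<le> measure M (?E - ?F) + measure M (pre k ?E - ?F)"
    using E F pre_sets[OF E, of k] by (intro measure_Un_le) auto
  also have "measure M (?E - ?F) = measure M ?E - measure M ?F"
    by (rule finite_measure_Diff[OF E F sub(1)])
  also have "measure M (pre k ?E - ?F) = measure M (pre k ?E) - measure M ?F"
    by (rule finite_measure_Diff[OF pre_sets[OF E] F sub(2)])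
  also have "measure M (pre k ?E) = measure M ?E" by (rule measure_pre[OF E])
  finally show ?thesis using surv_decreases_slowly(2)[OF assms, of k s] by (simp add: algebra_simps)
qed

lemma surv_decouples:
  assumes \<epsilon>: "0 < \<epsilon>"
  obtains u where "0 < u"
    and "\<And>N U s n Q. 1 \<le> N \<Longrightarrow> U \<in> cyl N \<Longrightarrow> real N * measure M U \<le> u \<Longrightarrow> 1 \<le> n \<Longrightarrow> saturated n Q \<Longrightarrow>
      measure M (Q \<inter> pre n (surv U s)) \<le> (1 + \<epsilon>) * measure M (surv U s) * measure M Q"
    and "\<And>N U s n Q. 1 \<le> N \<Longrightarrow> U \<in> cyl N \<Longrightarrow> real N * measure M U \<le> u \<Longrightarrow> 1 \<le> n \<Longrightarrow> saturated n Q \<Longrightarrow>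
      (1 - \<epsilon>) * measure M (surv U s) * measure M Q \<le> measure M (Q \<inter> pre n (surv U s))"
proof (rule nearly_invariant_decouples[OF \<epsilon>])
  fix K \<eta>
  assume \<eta>: "0 < \<eta>"
    and dec: "\<And>E n C. E \<in> sets M \<Longrightarrow>
      (\<And>k. k \<le> K \<Longrightarrow> measure M ((E - pre k E) \<union> (pre k E - E)) \<le> \<eta> * measure M E) \<Longrightarrow>
      1 \<le> n \<Longrightarrow> C \<in> cyl n \<Longrightarrow>
      \<bar>measure M (C \<inter> pre n E) - measure M C * measure M E\<bar> \<le> \<epsilon> * (measure M C * measure M E)"
  define u where "u = min (1 / (4 * D)) (\<eta> / (4 * D * (real K + 1)))"
  have u: "0 < u" using D \<eta> by (simp add: u_def)
  have main: "\<bar>measure M (C \<inter> pre n (surv U s)) - measure M C * measure M (surv U s)\<bar>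
      \<le> \<epsilon> * (measure M C * measure M (surv U s))"
    if N: "1 \<le> N" and U: "U \<in> cyl N" and Nu: "real N * measure M U \<le> u" and n: "1 \<le> n" "C \<in> cyl n"
    for N U s n C
  proof (rule dec[OF surv_sets[OF cyl_sets[OF U]] _ n])
    have "real N * measure M U \<le> 1 / (4 * D)" using Nu by (simp add: u_def)
    then have small: "4 * D * real N * measure M U \<le> 1"
      using D by (simp add: pos_le_divide_eq mult_ac)
    fix k assume k: "k \<le> K"
    have "measure M U \<le> real N * measure M U" using N mult_right_mono[of 1 "real N" "measure M U"] by simp
    also have "\<dots> \<le> \<eta> / (4 * D * (real K + 1))" using Nu by (simp add: u_def)
    finally have "4 * D * (real K + 1) * measure M U \<le> \<eta>"
      using D by (simp add: pos_le_divide_eq mult_ac)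
    moreover have "4 * D * real k * measure M U \<le> 4 * D * (real K + 1) * measure M U"
      using D k by (intro mult_right_mono mult_left_mono) auto
    ultimately have "4 * D * real k * measure M U * measure M (surv U s) \<le> \<eta> * measure M (surv U s)"
      by (intro mult_right_mono) auto
    with surv_nearly_invariant[OF N U small, of s k]
    show "measure M ((surv U s - pre k (surv U s)) \<union> (pre k (surv U s) - surv U s)) \<le> \<eta> * measure M (surv U s)"
      by linarith
  qed
  show ?thesis
  proof (rule that[OF u])
    fix N U s n Q
    assume N: "1 \<le> N" and U: "U \<in> cyl N" and Nu: "real N * measure M U \<le> u" and n: "1 \<le> n"
      and Q: "saturated n Q"
    let ?p = "measure M (surv U s)"
    have S: "pre n (surv U s) \<in> sets M" by (intro pre_sets surv_sets cyl_sets[OF U])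
    have Q_sp: "Q \<inter> space M = Q" using Q by (auto simp: saturated_def)
    have "1 * measure M (Q \<inter> pre n (surv U s)) \<le> (1 + \<epsilon>) * ?p * measure M (Q \<inter> space M)"
    proof (rule saturated_measure_le[OF Q S sets.top])
      fix C assume C: "C \<in> cyl n"
      show "1 * measure M (C \<inter> pre n (surv U s)) \<le> (1 + \<epsilon>) * ?p * measure M (C \<inter> space M)"
        using main[OF N U Nu n C, of s] Int_absorb2[OF cyl_subset_space[OF C]]
        by (simp add: abs_le_iff algebra_simps)
    qed
    then show "measure M (Q \<inter> pre n (surv U s)) \<le> (1 + \<epsilon>) * ?p * measure M Q"
      by (simp only: Q_sp mult_1)
    have "(1 - \<epsilon>) * ?p * measure M (Q \<inter> space M) \<le> 1 * measure M (Q \<inter> pre n (surv U s))"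
    proof (rule saturated_measure_le[OF Q sets.top S])
      fix C assume C: "C \<in> cyl n"
      show "(1 - \<epsilon>) * ?p * measure M (C \<inter> space M) \<le> 1 * measure M (C \<inter> pre n (surv U s))"
        using main[OF N U Nu n C, of s] Int_absorb2[OF cyl_subset_space[OF C]]
        by (simp add: abs_le_iff algebra_simps)
    qed
    then show "(1 - \<epsilon>) * ?p * measure M Q \<le> measure M (Q \<inter> pre n (surv U s))"
      by (simp only: Q_sp mult_1)
  qed
qed

section \<open>Measures of cylinders\<close>

lemma singleton_sets: "z \<in> space M \<Longrightarrow> {z} \<in> sets M"
proof -
  assume z: "z \<in> space M"
  have "(\<Inter>n. cyl_at n z) \<in> sets M" using cyl_at_sets[OF z] by auto
  then show ?thesis by (simp only: Inter_cyl_at[OF z])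
qed

lemma measure_cyl_at_tendsto:
  assumes z: "z \<in> space M"
  shows "(\<lambda>n. measure M (cyl_at n z)) \<longlonglongrightarrow> measure M {z}"
proof -
  have "(\<lambda>n. measure M (cyl_at n z)) \<longlonglongrightarrow> measure M (\<Inter>n. cyl_at n z)"
    using cyl_at_sets[OF z] cyl_at_antimono[OF z]
    by (intro finite_Lim_measure_decseq) (auto simp: decseq_def)
  then show ?thesis by (simp only: Inter_cyl_at[OF z])
qed

text \<open>
  Otherwise the points whose \<open>k\<close>-cylinders are larger than \<open>c\<close> form a decreasing sequence of sets of
  measure at least \<open>c\<close>. A point in their intersection has only cylinders larger than \<open>c\<close>, so it is
  an atom.
\<close>

lemma cylinders_uniformly_small:
  assumes no_atoms: "\<And>z. z \<in> space M \<Longrightarrow> measure M {z} = 0" and c: "0 < c"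
  obtains k where "1 \<le> k" and "\<And>C. C \<in> cyl k \<Longrightarrow> measure M C \<le> c"
proof (rule ccontr)
  assume "\<not> thesis"
  then have large: "\<exists>C\<in>cyl k. c < measure M C" if "1 \<le> k" for k
    using that \<open>\<And>k. 1 \<le> k \<Longrightarrow> (\<And>C. C \<in> cyl k \<Longrightarrow> measure M C \<le> c) \<Longrightarrow> thesis\<close>[of k] by (meson not_le)
  define B where "B k = {z \<in> space M. c < measure M (cyl_at (Suc k) z)}" for k
  have "saturated (Suc k) (B k)" for k
    unfolding saturated_def B_def
  proof (intro conjI ballI subsetI)
    fix z y assume z: "z \<in> {z \<in> space M. c < measure M (cyl_at (Suc k) z)}" and y: "y \<in> cyl_at (Suc k) z"
    then have zM: "z \<in> space M" by blast
    have "y \<in> space M" by (rule cyl_in_space[OF cyl_at_in[OF zM] y])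
    with z cyl_at_same[OF zM y] show "y \<in> {z \<in> space M. c < measure M (cyl_at (Suc k) z)}" by simp
  qed auto
  then have B: "B k \<in> sets M" for k by (rule saturated_sets)
  have dec: "decseq B"
  proof (rule decseq_SucI, rule subsetI)
    fix k z assume z: "z \<in> B (Suc k)"
    then have "measure M (cyl_at (Suc (Suc k)) z) \<le> measure M (cyl_at (Suc k) z)"
      by (intro finite_measure_mono cyl_at_antimono cyl_at_sets) (auto simp: B_def)
    with z show "z \<in> B k" by (simp add: B_def)
  qed
  have "c \<le> measure M (B k)" for k
  proof -
    obtain C where C: "C \<in> cyl (Suc k)" "c < measure M C" using large[of "Suc k"] by auto
    have "C \<subseteq> B k"
      using C cyl_in_space[OF C(1)] cyl_at_eq[OF C(1)] by (auto simp: B_def)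
    then have "measure M C \<le> measure M (B k)" by (rule finite_measure_mono[OF _ B])
    with C(2) show ?thesis by linarith
  qed
  moreover have "(\<lambda>k. measure M (B k)) \<longlonglongrightarrow> measure M (\<Inter>k. B k)"
    using B by (intro finite_Lim_measure_decseq dec) auto
  ultimately have "c \<le> measure M (\<Inter>k. B k)" by (meson LIMSEQ_le_const)
  then have "(\<Inter>k. B k) \<noteq> {}" using c by auto
  then obtain z where z: "\<And>k. z \<in> B k" by blast
  then have zM: "z \<in> space M" by (simp add: B_def)
  have "(\<lambda>k. measure M (cyl_at (Suc k) z)) \<longlonglongrightarrow> measure M {z}"
    using measure_cyl_at_tendsto[OF zM] by (rule LIMSEQ_Suc)
  moreover have "c \<le> measure M (cyl_at (Suc k) z)" for k
    using z[of k] by (simp add: B_def)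
  ultimately have "c \<le> measure M {z}" by (meson LIMSEQ_le_const)
  with no_atoms[OF zM] c show False by simp
qed

text \<open>
  Once all \<open>k\<close>-cylinders have measure at most \<open>1 / (2 D)\<close>, adding \<open>k\<close> symbols halves the measure of a
  cylinder.
\<close>

lemma cyl_at_exponential_decay:
  assumes no_atoms: "\<And>z. z \<in> space M \<Longrightarrow> measure M {z} = 0" and z: "z \<in> space M"
  obtains \<gamma> where "0 < \<gamma>" "\<gamma> < 1" "\<And>n. measure M (cyl_at n z) \<le> 2 * \<gamma> ^ n"
proof -
  obtain k where k: "1 \<le> k" "\<And>C. C \<in> cyl k \<Longrightarrow> measure M C \<le> 1 / (2 * D)"
    using cylinders_uniformly_small[OF no_atoms, of "1 / (2 * D)"] D by auto
  have half: "measure M (cyl_at (n + k) z) \<le> measure M (cyl_at n z) / 2" if n: "1 \<le> n" for n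
  proof -
    let ?C = "cyl_at k ((T ^^ n) z)"
    have C: "?C \<in> cyl k" by (rule cyl_at_in[OF funpow_in_space[OF z]])
    have "measure M (cyl_at (n + k) z) \<le> D * measure M (cyl_at n z) * measure M ?C"
      unfolding cyl_at_add[OF z] by (rule cyl_pre_upper[OF n cyl_at_in[OF z] cyl_sets[OF C]])
    also have "\<dots> \<le> D * measure M (cyl_at n z) * (1 / (2 * D))"
      using D k(2)[OF C] by (intro mult_left_mono) auto
    also have "\<dots> = measure M (cyl_at n z) / 2" using D by simp
    finally show ?thesis .
  qed
  show ?thesis
    by (rule geometric_if_halving[of "\<lambda>n. measure M (cyl_at n z)", OF _ k(1) half]) (auto intro: that)
qed

section \<open>Loss of survivors in one step\<close>

text \<open>
  The set \<open>G N\<close> consists of the points of the cylinder that have no return forced by periodicity;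
  \<open>\<theta>\<close> is their asymptotic proportion. The remaining points of the cylinder return within \<open>m\<close> steps
  and contribute nothing to the loss. For points of \<open>G N\<close>, bounded return times are excluded by
  \<open>no_return\<close>, longer ones up to time \<open>N + m\<close> are controlled by the geometric decay of the
  cylinders of \<open>x\<close>, and all later ones by decoupling.
\<close>

lemma survivor_loss:
  fixes G :: "nat \<Rightarrow> 'a set"
  assumes x: "x \<in> space M"
    and \<gamma>: "0 < \<gamma>" "\<gamma> < 1" and decay: "\<And>n. measure M (cyl_at n x) \<le> 2 * \<gamma> ^ n"
    and G: "\<And>N. saturated (N + m) (G N)" "\<And>N. G N \<subseteq> cyl_at N x"
    and cover: "\<forall>\<^sub>F N in sequentially. cyl_at N x - G N \<subseteq> (\<Union>j\<in>{1..m}. pre j (cyl_at N x))"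
    and no_return: "\<And>j. 1 \<le> j \<Longrightarrow> \<forall>\<^sub>F N in sequentially. G N \<inter> pre j (cyl_at N x) = {}"
    and ratio: "(\<lambda>N. measure M (G N) / measure M (cyl_at N x)) \<longlonglongrightarrow> \<theta>"
    and \<epsilon>: "0 < \<epsilon>"
  shows "\<forall>\<^sub>F N in sequentially. \<forall>s\<ge>m.
      (\<theta> - \<epsilon>) * measure M (cyl_at N x) * measure M (surv (cyl_at N x) s)
        \<le> measure M (surv (cyl_at N x) s) - measure M (surv (cyl_at N x) (Suc s)) \<and>
      measure M (surv (cyl_at N x) s) - measure M (surv (cyl_at N x) (Suc s))
        \<le> (\<theta> + \<epsilon>) * measure M (cyl_at N x) * measure M (surv (cyl_at N x) s)"
proof -
  \<comment> \<open>The estimates below lose at most \<open>4 e\<close> altogether, using \<open>(1 + e)\<^sup>2 \<le> 1 + 3 e\<close>.\<close>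
  define e where "e = min \<epsilon> 1 / 4"
  have e: "0 < e" "e \<le> 1 / 4" "4 * e \<le> \<epsilon>" using \<epsilon> by (auto simp: e_def)
  obtain u where u: "0 < u"
    and decouple_le: "\<And>N U s n Q. 1 \<le> N \<Longrightarrow> U \<in> cyl N \<Longrightarrow> real N * measure M U \<le> u \<Longrightarrow> 1 \<le> n \<Longrightarrow> saturated n Q \<Longrightarrow>
      measure M (Q \<inter> pre n (surv U s)) \<le> (1 + e) * measure M (surv U s) * measure M Q"
    and decouple_ge: "\<And>N U s n Q. 1 \<le> N \<Longrightarrow> U \<in> cyl N \<Longrightarrow> real N * measure M U \<le> u \<Longrightarrow> 1 \<le> n \<Longrightarrow> saturated n Q \<Longrightarrow>
      (1 - e) * measure M (surv U s) * measure M Q \<le> measure M (Q \<inter> pre n (surv U s))"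
    using surv_decouples[OF e(1)] by metis
  \<comment> \<open>Returns after time \<open>m + R\<close> and before time \<open>N + m\<close> will cost at most a fraction
    \<open>4 D\<^sup>2 \<gamma>\<^sup>R / (1 - \<gamma>)\<close> of \<open>\<mu>(U) p\<^sub>s\<close>.\<close>
  have "(\<lambda>R. 4 * D\<^sup>2 / (1 - \<gamma>) * \<gamma> ^ R) \<longlonglongrightarrow> 4 * D\<^sup>2 / (1 - \<gamma>) * 0"
    using \<gamma> by (intro tendsto_mult tendsto_const LIMSEQ_power_zero) auto
  then have "\<forall>\<^sub>F R in sequentially. 4 * D\<^sup>2 / (1 - \<gamma>) * \<gamma> ^ R < e"
    using e(1) by (intro order_tendstoD) auto
  then obtain R where R: "4 * D\<^sup>2 / (1 - \<gamma>) * \<gamma> ^ R < e"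
    using eventually_happens'[OF sequentially_bot] by blast
  have lim: "(\<lambda>N. real (N + m) * measure M (cyl_at N x)) \<longlonglongrightarrow> 0"
  proof (rule tendsto_sandwich[of "\<lambda>_. 0"])
    have "(\<lambda>N. 2 * (real N * \<gamma> ^ N) + 2 * real m * \<gamma> ^ N) \<longlonglongrightarrow> 2 * 0 + 2 * real m * 0"
      using \<gamma> by (intro tendsto_add tendsto_mult tendsto_const LIMSEQ_power_zero powser_times_n_limit_0) auto
    then show "(\<lambda>N. real (N + m) * (2 * \<gamma> ^ N)) \<longlonglongrightarrow> 0" by (simp add: algebra_simps)
    show "\<forall>\<^sub>F N in sequentially. real (N + m) * measure M (cyl_at N x) \<le> real (N + m) * (2 * \<gamma> ^ N)"
      using decay by (intro always_eventually allI mult_left_mono) auto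
  qed (auto intro: always_eventually)
  have "\<forall>\<^sub>F N in sequentially. \<forall>j\<in>{1..m + R}. G N \<inter> pre j (cyl_at N x) = {}"
    using no_return by (intro eventually_ball_finite) auto
  moreover have "\<forall>\<^sub>F N in sequentially. real (N + m) * measure M (cyl_at N x) < min u (e / (4 * D))"
    using u e(1) D by (intro order_tendstoD(2)[OF lim]) auto
  moreover have "\<forall>\<^sub>F N in sequentially. \<bar>measure M (G N) / measure M (cyl_at N x) - \<theta>\<bar> < e"
    using ratio e(1) by (auto simp: tendsto_iff dist_real_def)
  ultimately show ?thesis
    using cover eventually_ge_at_top[of 1]
  proof eventually_elim
    case (elim N)
    define U where "U = cyl_at N x"
    define p where "p s = measure M (surv U s)" for s
    have N: "1 \<le> N" by (rule elim(5))
    have U: "U \<in> cyl N" unfolding U_def by (rule cyl_at_in[OF x])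
    note UM = cyl_sets[OF U]
    have U0: "0 < measure M U" by (rule cyl_pos[OF N U])
    have NU_le: "real N * measure M U \<le> real (N + m) * measure M U" by (intro mult_right_mono) auto
    have Nu: "real N * measure M U \<le> u" using NU_le elim(2) by (simp add: U_def)
    have NmU: "4 * D * (real (N + m) * measure M U) \<le> e"
      using elim(2) D by (simp add: U_def pos_less_divide_eq mult_ac)
    have "4 * D * (real N * measure M U) \<le> 4 * D * (real (N + m) * measure M U)"
      using NU_le D by (intro mult_left_mono) auto
    then have small: "4 * D * real N * measure M U \<le> 1" using NmU e(2) by (simp add: mult.assoc)
    have p0: "0 \<le> p s" for s by (simp add: p_def)
    have prev: "(1 - e / 2) * p (s - (N + m)) \<le> p s" for s
    proof -
      define k where "k = min (N + m) s"
      have k: "s - k = s - (N + m)" "s - k + k = s" "k \<le> N + m" by (auto simp: k_def)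
      have "4 * D * (real k * measure M U) \<le> 4 * D * (real (N + m) * measure M U)"
        using D k(3) by (intro mult_left_mono mult_right_mono) auto
      then have "1 - e / 2 \<le> 1 - 2 * D * measure M U * real k" using NmU by (simp add: mult_ac)
      then have "(1 - e / 2) * p (s - k) \<le> (1 - 2 * D * measure M U * real k) * p (s - k)"
        by (intro mult_right_mono p0)
      also have "\<dots> \<le> p (s - k + k)"
        unfolding p_def by (rule surv_decreases_slowly(2)[OF N U small])
      finally show ?thesis using k by simp
    qed
    have GM: "G N \<in> sets M" by (rule saturated_sets[OF G(1)])
    have GU: "G N \<subseteq> U" using G(2) by (simp add: U_def)
    define q where "q = measure M (G N) / measure M U"
    have mG: "measure M (G N) = q * measure M U" using U0 by (simp add: q_def)
    have q0: "0 \<le> q" by (simp add: q_def)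
    have q1: "q \<le> 1" using U0 finite_measure_mono[OF GU UM] by (simp add: q_def)
    have q\<theta>: "\<bar>q - \<theta>\<bar> < e" using elim(3) by (simp add: q_def U_def)
    have Nm: "1 \<le> N + m" using N by simp
    show ?case
    proof (intro allI impI)
      fix s assume s: "m \<le> s"
      let ?s = "s - (N + m)"
      have loss: "p s - p (Suc s) = measure M (U \<inter> pre 1 (surv U s))"
        unfolding p_def by (rule surv_Suc_diff[OF UM])
      \<comment> \<open>Upper bound: a surviving point of \<open>U\<close> lies in \<open>G N\<close>, which is decoupled from the time
        after \<open>N + m\<close>.\<close>
      have "U \<inter> pre 1 (surv U s) \<subseteq> G N \<inter> pre (N + m) (surv U ?s)"
      proof
        fix z assume z: "z \<in> U \<inter> pre 1 (surv U s)"
        have "z \<in> G N"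
        proof (rule ccontr)
          assume "z \<notin> G N"
          with z elim(4) have "z \<in> (\<Union>j\<in>{1..m}. pre j U)" unfolding U_def by blast
          then obtain j where j: "1 \<le> j" "j \<le> m" "(T ^^ j) z \<in> U" by auto
          moreover have "(T ^^ j) z = (T ^^ (j - 1)) (T z)"
            using j(1) by (cases j) (auto simp: funpow_swap1)
          ultimately have "(T ^^ (j - 1)) (T z) \<in> U" by simp
          moreover have "(T ^^ (j - 1)) (T z) \<notin> U"
            using z j s by (auto simp: surv_def)
          ultimately show False by contradiction
        qed
        moreover have "z \<in> pre (N + m) (surv U ?s)"
        proof (cases "N + m \<le> s")
          case True
          then show ?thesis using pre_surv_shift[of 1 "N + m" ?s s U] Nm z by auto
        next
          case False
          then show ?thesis using z by (auto simp: surv_0 funpow_in_space)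
        qed
        ultimately show "z \<in> G N \<inter> pre (N + m) (surv U ?s)" by blast
      qed
      then have "p s - p (Suc s) \<le> measure M (G N \<inter> pre (N + m) (surv U ?s))"
        unfolding loss using GM pre_sets[OF surv_sets[OF UM]] by (intro finite_measure_mono) auto
      also have "\<dots> \<le> (1 + e) * p ?s * (q * measure M U)"
        unfolding p_def mG[symmetric] by (rule decouple_le[OF N U Nu Nm G(1)])
      also have "\<dots> \<le> (1 + e) * ((1 + e) * p s) * (q * measure M U)"
      proof -
        have "1 * p ?s \<le> (1 + e) * (1 - e / 2) * p ?s"
          using e by (intro mult_right_mono p0) (simp add: algebra_simps)
        also have "\<dots> = (1 + e) * ((1 - e / 2) * p ?s)" by simp
        also have "\<dots> \<le> (1 + e) * p s" using e by (intro mult_left_mono prev) auto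
        finally show ?thesis using e q0 by (intro mult_right_mono mult_left_mono) auto
      qed
      also have "\<dots> = ((1 + e) * (1 + e) * q) * (measure M U * p s)" by simp
      also have "\<dots> \<le> (\<theta> + \<epsilon>) * (measure M U * p s)"
      proof (intro mult_right_mono mult_nonneg_nonneg p0 measure_nonneg)
        have "(1 + e) * (1 + e) \<le> 1 + 3 * e" using e by (simp add: algebra_simps)
        then have "(1 + e) * (1 + e) * q \<le> (1 + 3 * e) * q" using q0 by (rule mult_right_mono)
        also have "\<dots> \<le> q + 3 * e" using mult_left_mono[OF q1, of "3 * e"] e by (simp add: algebra_simps)
        finally show "(1 + e) * (1 + e) * q \<le> \<theta> + \<epsilon>" using q\<theta> e by linarith
      qed
      finally have le: "p s - p (Suc s) \<le> (\<theta> + \<epsilon>) * measure M U * p s" by simp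
      \<comment> \<open>Lower bound: points of \<open>G N\<close> that survive after time \<open>N + m\<close> and do not return earlier.\<close>
      let ?V = "\<lambda>j. G N \<inter> pre j U \<inter> pre (N + m) (surv U s)"
      let ?J = "{m + R + 1..<N + m}"
      have VM: "?V j \<in> sets M" for j
        using GM pre_sets[OF UM] pre_sets[OF surv_sets[OF UM]] by auto
      have "G N \<inter> pre (N + m) (surv U s) \<subseteq> (U \<inter> pre 1 (surv U s)) \<union> (\<Union>j\<in>?J. ?V j)"
      proof
        fix z assume z: "z \<in> G N \<inter> pre (N + m) (surv U s)"
        show "z \<in> (U \<inter> pre 1 (surv U s)) \<union> (\<Union>j\<in>?J. ?V j)"
        proof (rule ccontr)
          assume not: "\<not> ?thesis"
          then have "z \<notin> pre 1 (surv U s)" using z GU by blast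
          moreover have zM: "z \<in> space M" using z by blast
          ultimately obtain i where i: "i < s" "(T ^^ i) (T z) \<in> U"
            by (auto simp: surv_def measurable_space[OF T_measurable])
          define j where "j = Suc i"
          have j: "1 \<le> j" "j \<le> s" "(T ^^ j) z \<in> U"
            using i by (auto simp: j_def funpow_swap1)
          have "\<not> N + m \<le> j"
          proof
            assume "N + m \<le> j"
            then have "(T ^^ (j - (N + m))) ((T ^^ (N + m)) z) \<in> U"
              using j(3) funpow_add[of "j - (N + m)" "N + m" T] by simp
            moreover have "(T ^^ (j - (N + m))) ((T ^^ (N + m)) z) \<notin> U"
              using z j Nm by (auto simp: surv_def)
            ultimately show False by contradiction
          qed
          moreover have "\<not> j \<le> m + R"
          proof
            assume "j \<le> m + R"
            then have "G N \<inter> pre j U = {}" using elim(1) j(1) by (simp add: U_def)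
            with z zM j(3) show False by blast
          qed
          ultimately show False using not z j(3) zM by auto
        qed
      qed
      then have "measure M (G N \<inter> pre (N + m) (surv U s))
          \<le> measure M ((U \<inter> pre 1 (surv U s)) \<union> (\<Union>j\<in>?J. ?V j))"
        by (rule finite_measure_mono)
          (intro sets.Un sets.finite_UN finite_atLeastLessThan VM cyl_pre_sets[OF U surv_sets[OF UM]])
      also have "\<dots> \<le> measure M (U \<inter> pre 1 (surv U s)) + measure M (\<Union>j\<in>?J. ?V j)"
        by (intro measure_Un_le sets.finite_UN finite_atLeastLessThan VM cyl_pre_sets[OF U surv_sets[OF UM]])
      also have "measure M (\<Union>j\<in>?J. ?V j) \<le> (\<Sum>j\<in>?J. measure M (?V j))"
        using VM by (intro measure_UNION_le finite_atLeastLessThan)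
      also have "(\<Sum>j\<in>?J. measure M (?V j)) \<le> (\<Sum>j\<in>?J. 2 * D\<^sup>2 * measure M U * p ?s * \<gamma> ^ (j - m))"
      proof (rule sum_mono)
        fix j assume j: "j \<in> ?J"
        \<comment> \<open>\<open>G N\<close> lies in the cylinders of \<open>x\<close> of order at most \<open>N\<close> only. Since \<open>j < N + m\<close>,
          capping \<open>j\<close> at \<open>N\<close> loses at most \<open>m\<close> in the exponent of \<open>\<gamma>\<close>.\<close>
        define i where "i = min j N"
        have i: "1 \<le> i" "i \<le> j" "i \<le> N" "j - m \<le> i" using j N by (auto simp: i_def)
        let ?E = "U \<inter> pre N (surv U ?s)"
        have EM: "?E \<in> sets M" by (rule cyl_pre_sets[OF U surv_sets[OF UM]])
        have Ci: "cyl_at i x \<in> cyl i" by (rule cyl_at_in[OF x])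
        have sub: "?V j \<subseteq> cyl_at i x \<inter> pre i (pre (j - i) ?E)"
        proof
          fix z assume z: "z \<in> ?V j"
          then have zM: "z \<in> space M" by blast
          have "z \<in> cyl_at i x" using z G(2) cyl_at_antimono[OF x i(3)] by blast
          moreover have "z \<in> pre (j + N) (surv U ?s)"
          proof (cases "N + m \<le> s")
            case True
            have "N + m \<le> j + N" using j by simp
            moreover have "j < N + m" using j by simp
            then have "j + N + ?s \<le> N + m + s" using True by arith
            ultimately show ?thesis using pre_surv_shift z by blast
          next
            case False
            then show ?thesis using zM by (auto simp: surv_0 funpow_in_space)
          qed
          then have "(T ^^ N) ((T ^^ j) z) \<in> surv U ?s"
            using funpow_add[of N j T] by (simp add: add.commute)
          then have "z \<in> pre j ?E" using z zM by (auto simp: funpow_in_space)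
          then have "z \<in> pre i (pre (j - i) ?E)" using i(2) by (simp only: pre_pre le_add_diff_inverse)
          ultimately show "z \<in> cyl_at i x \<inter> pre i (pre (j - i) ?E)" by blast
        qed
        have "measure M (?V j) \<le> measure M (cyl_at i x \<inter> pre i (pre (j - i) ?E))"
          by (rule finite_measure_mono[OF sub cyl_pre_sets[OF Ci pre_sets[OF EM]]])
        also have "\<dots> \<le> D * measure M (cyl_at i x) * measure M (pre (j - i) ?E)"
          by (rule cyl_pre_upper[OF i(1) Ci pre_sets[OF EM]])
        also have "measure M (pre (j - i) ?E) = measure M ?E" by (rule measure_pre[OF EM])
        also have "D * measure M (cyl_at i x) * measure M ?E
            \<le> D * (2 * \<gamma> ^ (j - m)) * (D * measure M U * p ?s)"
        proof (intro mult_mono mult_left_mono)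
          have "measure M (cyl_at i x) \<le> 2 * \<gamma> ^ i" by (rule decay)
          also have "\<gamma> ^ i \<le> \<gamma> ^ (j - m)" using i(4) \<gamma> by (intro power_decreasing) auto
          finally show "measure M (cyl_at i x) \<le> 2 * \<gamma> ^ (j - m)" by simp
          show "measure M ?E \<le> D * measure M U * p ?s"
            unfolding p_def by (rule cyl_pre_upper[OF N U surv_sets[OF UM]])
        qed (use D \<gamma> in auto)
        finally show "measure M (?V j) \<le> 2 * D\<^sup>2 * measure M U * p ?s * \<gamma> ^ (j - m)"
          by (simp add: power2_eq_square mult_ac)
      qed
      also have "\<dots> = 2 * D\<^sup>2 * measure M U * p ?s * (\<Sum>j\<in>?J. \<gamma> ^ (j - m))"
        by (rule sum_distrib_left[symmetric])
      also have "\<dots> \<le> 2 * D\<^sup>2 * measure M U * p ?s * (\<gamma> ^ R / (1 - \<gamma>))"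
      proof (intro mult_left_mono)
        have "(\<Sum>j\<in>?J. \<gamma> ^ (j - m)) \<le> \<gamma> ^ (m + R + 1 - m) / (1 - \<gamma>)"
          by (rule geometric_sum_le[OF \<gamma>]) simp
        also have "\<dots> \<le> \<gamma> ^ R / (1 - \<gamma>)"
          using \<gamma> by (intro divide_right_mono power_decreasing) auto
        finally show "(\<Sum>j\<in>?J. \<gamma> ^ (j - m)) \<le> \<gamma> ^ R / (1 - \<gamma>)" .
      qed (use D p0 in auto)
      also have "\<dots> \<le> e * (measure M U * p s)"
      proof -
        have "2 * D\<^sup>2 * measure M U * p ?s * (\<gamma> ^ R / (1 - \<gamma>))
            = (4 * D\<^sup>2 / (1 - \<gamma>) * \<gamma> ^ R) * (measure M U * (p ?s / 2))"
          using \<gamma> by (simp add: field_simps)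
        also have "\<dots> \<le> e * (measure M U * p s)"
        proof (intro mult_mono mult_left_mono)
          have "1 / 2 * p ?s \<le> (1 - e / 2) * p ?s" using e by (intro mult_right_mono p0) auto
          then show "p ?s / 2 \<le> p s" using prev[of s] by simp
        qed (use R e p0 in auto)
        finally show ?thesis .
      qed
      finally have "measure M (G N \<inter> pre (N + m) (surv U s)) \<le> p s - p (Suc s) + e * (measure M U * p s)"
        unfolding loss by simp
      moreover have "(1 - e) * p s * (q * measure M U) \<le> measure M (G N \<inter> pre (N + m) (surv U s))"
        unfolding p_def mG[symmetric] by (rule decouple_ge[OF N U Nu Nm G(1)])
      ultimately have "((1 - e) * q - e) * (measure M U * p s) \<le> p s - p (Suc s)"
        by (simp add: algebra_simps)
      moreover have "(\<theta> - \<epsilon>) * (measure M U * p s) \<le> ((1 - e) * q - e) * (measure M U * p s)"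
      proof (intro mult_right_mono mult_nonneg_nonneg p0 measure_nonneg)
        have "e * q \<le> e" using mult_left_mono[OF q1, of e] e by simp
        moreover have "(1 - e) * q - e = q - e * q - e" by (simp add: algebra_simps)
        ultimately show "\<theta> - \<epsilon> \<le> (1 - e) * q - e" using q\<theta> e by linarith
      qed
      ultimately have ge: "(\<theta> - \<epsilon>) * measure M U * p s \<le> p s - p (Suc s)" by simp
      from le ge show "(\<theta> - \<epsilon>) * measure M (cyl_at N x) * measure M (surv (cyl_at N x) s)
        \<le> measure M (surv (cyl_at N x) s) - measure M (surv (cyl_at N x) (Suc s)) \<and>
      measure M (surv (cyl_at N x) s) - measure M (surv (cyl_at N x) (Suc s))
        \<le> (\<theta> + \<epsilon>) * measure M (cyl_at N x) * measure M (surv (cyl_at N x) s)"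
        by (simp add: p_def U_def)
    qed
  qed
qed

section \<open>Escape rates\<close>

lemma hitting_time_survivors: "{z \<in> space M. hitting_time T U z > enat t} = pre 1 (surv U t)"
proof -
  have "enat t < hitting_time T U z \<longleftrightarrow> (\<forall>j<t. (T ^^ j) (T z) \<notin> U)" for z
  proof -
    have "enat t < hitting_time T U z \<longleftrightarrow> enat (Suc t) \<le> hitting_time T U z"
      by (simp add: Suc_ile_eq)
    also have "\<dots> \<longleftrightarrow> (\<forall>j. 1 \<le> j \<and> (T ^^ j) z \<in> U \<longrightarrow> t < j)"
      by (auto simp: hitting_time_def le_Inf_iff)
    also have "\<dots> \<longleftrightarrow> (\<forall>i<t. (T ^^ Suc i) z \<notin> U)"
    proof safe
      fix i assume "\<forall>j. 1 \<le> j \<and> (T ^^ j) z \<in> U \<longrightarrow> t < j" "i < t" "(T ^^ Suc i) z \<in> U"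
      then have "t < Suc i" by (metis One_nat_def Suc_le_mono le0)
      with \<open>i < t\<close> show False by simp
    next
      fix j assume a: "\<forall>i<t. (T ^^ Suc i) z \<notin> U" "1 \<le> j" "(T ^^ j) z \<in> U"
      show "t < j"
      proof (rule ccontr)
        assume "\<not> t < j"
        then have "j - 1 < t" "Suc (j - 1) = j" using a(2) by auto
        with a(1,3) show False by metis
      qed
    qed
    finally show ?thesis by (simp add: funpow_swap1)
  qed
  then show ?thesis by (auto simp: surv_def measurable_space[OF T_measurable])
qed

lemma escape_seq_eq:
  assumes U: "U \<in> sets M" and pos: "0 < measure M (surv U t)"
  shows "escape_seq M T U t = ereal (- ln (measure M (surv U t)) / real t)"
proof -
  have "ln (measure M (surv U t)) \<le> 0" using pos by simp
  then show ?thesis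
    unfolding escape_seq_def hitting_time_survivors measure_pre[OF surv_sets[OF U]]
    using pos by (simp add: abs_ln_def)
qed

text \<open>
  The set \<open>F\<^sub>s\<close> is a union of cylinders of order \<open>s + N\<close>, so the upper distortion bound makes the
  survival probabilities submultiplicative with gap \<open>N\<close> and constant \<open>D\<close>.
\<close>

lemma survival_rate_converges:
  assumes N: "1 \<le> N" and U: "U \<in> cyl N" and small: "4 * D * real N * measure M U \<le> 1"
  shows "convergent (\<lambda>t. - ln (measure M (surv U t)) / real t)"
proof (rule almost_superadditive_converges)
  let ?p = "\<lambda>s. measure M (surv U s)"
  note pos = surv_decreases_slowly(1)[OF N U small] and UM = cyl_sets[OF U]
  show "0 \<le> - ln (?p n)" for n using pos[of n] by simp
  show "incseq (\<lambda>n. - ln (?p n))"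
    using pos by (intro incseq_SucI) (auto intro!: finite_measure_mono surv_antimono surv_sets[OF UM])
  show "1 \<le> N" by (rule N)
  let ?a = "2 * D * measure M U"
  have "measure M U \<le> real N * measure M U" using N mult_right_mono[of 1 "real N" "measure M U"] by simp
  then have "4 * D * measure M U \<le> 4 * D * (real N * measure M U)" using D by (intro mult_left_mono) auto
  then have a: "?a \<le> 1 / 2" using small by (simp add: mult.assoc)
  show "- ln (?p n) \<le> 0 + - ln (1 - ?a) * real n" for n
  proof -
    have "(1 - ?a) ^ n \<le> ?p n"
    proof (induction n)
      case (Suc n)
      have "(1 - ?a) ^ Suc n \<le> (1 - ?a) * ?p n" using Suc a by simp
      also have "\<dots> \<le> ?p (Suc n)" using surv_decreases_slowly(2)[OF N U small, of 1 n] by simp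
      finally show ?case .
    qed (simp add: surv_0 prob_space)
    then have "ln ((1 - ?a) ^ n) \<le> ln (?p n)" using a pos[of n] by (intro ln_mono) auto
    then show ?thesis using a by (simp add: ln_realpow mult.commute)
  qed
  show "- ln (?p s) + - ln (?p t) - ln D \<le> - ln (?p (s + t + N))" for s t
  proof -
    have "surv U (s + t + N) \<subseteq> surv U s \<inter> pre (s + N) (surv U t)"
      using surv_antimono[of s "s + t + N" U] surv_shift[of "s + N" t "s + t + N" U] by auto
    then have "1 * ?p (s + t + N) \<le> 1 * measure M (surv U s \<inter> pre (s + N) (surv U t))"
      using surv_sets[OF UM] pre_sets[OF surv_sets[OF UM]] by (auto intro!: finite_measure_mono)
    also have "\<dots> \<le> D * ?p t * measure M (surv U s \<inter> space M)"
    proof (rule saturated_measure_le[OF surv_saturated[OF U] pre_sets[OF surv_sets[OF UM]] sets.top])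
      fix C assume C: "C \<in> cyl (s + N)"
      show "1 * measure M (C \<inter> pre (s + N) (surv U t)) \<le> D * ?p t * measure M (C \<inter> space M)"
        using cyl_pre_upper[OF _ C surv_sets[OF UM, of t]] N Int_absorb2[OF cyl_subset_space[OF C]]
        by (simp add: mult_ac)
    qed
    also have "surv U s \<inter> space M = surv U s"
      using sets.sets_into_space[OF surv_sets[OF UM]] by (rule Int_absorb2)
    finally have "?p (s + t + N) \<le> D * ?p t * ?p s" by simp
    then have "ln (?p (s + t + N)) \<le> ln (D * ?p t * ?p s)"
      by (rule ln_mono[OF _ pos])
    also have "\<dots> = ln D + ln (?p t) + ln (?p s)"
      using pos[of t] pos[of s] D by (simp add: ln_mult)
    finally show ?thesis by simp
  qed
qed

lemma local_escape_rate:
  fixes G :: "nat \<Rightarrow> 'a set"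
  assumes x: "x \<in> space M" and no_atoms: "\<And>z. z \<in> space M \<Longrightarrow> measure M {z} = 0"
    and G: "\<And>N. saturated (N + m) (G N)" "\<And>N. G N \<subseteq> cyl_at N x"
    and cover: "\<forall>\<^sub>F N in sequentially. cyl_at N x - G N \<subseteq> (\<Union>j\<in>{1..m}. pre j (cyl_at N x))"
    and no_return: "\<And>j. 1 \<le> j \<Longrightarrow> \<forall>\<^sub>F N in sequentially. G N \<inter> pre j (cyl_at N x) = {}"
    and ratio: "(\<lambda>N. measure M (G N) / measure M (cyl_at N x)) \<longlonglongrightarrow> \<theta>"
  shows "has_local_escape_rate M T (\<lambda>n. cyl_at n x) \<theta>"
proof -
  obtain \<gamma> where \<gamma>: "0 < \<gamma>" "\<gamma> < 1" and decay: "\<And>n. measure M (cyl_at n x) \<le> 2 * \<gamma> ^ n"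
    using cyl_at_exponential_decay[OF no_atoms x] by blast
  let ?\<mu> = "\<lambda>N. measure M (cyl_at N x)"
  let ?r = "\<lambda>N. lim (\<lambda>t. - ln (measure M (surv (cyl_at N x) t)) / real t)"
  have "(\<lambda>N. 2 * (real N * \<gamma> ^ N)) \<longlonglongrightarrow> 2 * 0"
    using \<gamma> by (intro tendsto_mult tendsto_const powser_times_n_limit_0) simp
  then have "(\<lambda>N. 2 * (real N * \<gamma> ^ N)) \<longlonglongrightarrow> 0" by simp
  then have N\<mu>: "(\<lambda>N. real N * ?\<mu> N) \<longlonglongrightarrow> 0"
  proof (rule tendsto_sandwich[of "\<lambda>_. 0" _ _ "\<lambda>N. 2 * (real N * \<gamma> ^ N)", rotated 3])
    show "\<forall>\<^sub>F N in sequentially. real N * ?\<mu> N \<le> 2 * (real N * \<gamma> ^ N)"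
      using mult_left_mono[OF decay] by (simp add: mult.left_commute)
  qed simp_all
  have "(\<lambda>N. 2 * \<gamma> ^ N) \<longlonglongrightarrow> 2 * 0"
    using \<gamma> by (intro tendsto_mult tendsto_const LIMSEQ_power_zero) auto
  then have \<mu>: "?\<mu> \<longlonglongrightarrow> 0"
    by (intro tendsto_sandwich[of "\<lambda>_. 0" ?\<mu> _ "\<lambda>N. 2 * \<gamma> ^ N"]) (simp_all add: decay)
  have "\<forall>\<^sub>F N in sequentially. real N * ?\<mu> N < 1 / (4 * D)"
    using D by (intro order_tendstoD(2)[OF N\<mu>]) auto
  then have good: "\<forall>\<^sub>F N in sequentially. 1 \<le> N \<and> 4 * D * real N * ?\<mu> N \<le> 1"
    using eventually_ge_at_top[of 1]
    by eventually_elim (use D in \<open>simp add: pos_less_divide_eq mult_ac\<close>)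
  have rate: "escape_seq M T (cyl_at N x) \<longlonglongrightarrow> ereal (?r N)"
    and real_rate: "(\<lambda>t. - ln (measure M (surv (cyl_at N x) t)) / real t) \<longlonglongrightarrow> ?r N"
    if N: "1 \<le> N" "4 * D * real N * ?\<mu> N \<le> 1" for N
  proof -
    note U = cyl_at_in[OF x, of N]
    show 1: "(\<lambda>t. - ln (measure M (surv (cyl_at N x) t)) / real t) \<longlonglongrightarrow> ?r N"
      using survival_rate_converges[OF N(1) U N(2)] by (simp only: convergent_LIMSEQ_iff)
    have "escape_seq M T (cyl_at N x) = (\<lambda>t. ereal (- ln (measure M (surv (cyl_at N x) t)) / real t))"
      by (rule ext) (rule escape_seq_eq[OF cyl_sets[OF U] surv_decreases_slowly(1)[OF N(1) U N(2)]])
    with 1 show "escape_seq M T (cyl_at N x) \<longlonglongrightarrow> ereal (?r N)" by simp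
  qed
  have "(\<lambda>N. ?r N / ?\<mu> N) \<longlonglongrightarrow> \<theta>"
  proof (rule tendstoI)
    fix e :: real assume e: "0 < e"
    define c where "c = e / 3"
    have c: "0 < c" using e by (simp add: c_def)
    have "(\<lambda>N. (\<theta> + c) / (1 - (\<theta> + c) * ?\<mu> N)) \<longlonglongrightarrow> (\<theta> + c) / (1 - (\<theta> + c) * 0)"
      by (intro tendsto_divide tendsto_diff tendsto_mult tendsto_const \<mu>) auto
    then have "\<forall>\<^sub>F N in sequentially. (\<theta> + c) / (1 - (\<theta> + c) * ?\<mu> N) < \<theta> + 2 * c"
      using c by (intro order_tendstoD) auto
    moreover have "\<forall>\<^sub>F N in sequentially. (\<theta> - c) * ?\<mu> N < 1" "\<forall>\<^sub>F N in sequentially. (\<theta> + c) * ?\<mu> N < 1"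
      using order_tendstoD(2)[OF tendsto_mult_right_zero[OF \<mu>], of 1] by auto
    moreover have "\<forall>\<^sub>F N in sequentially. \<forall>s\<ge>m.
      (\<theta> - c) * ?\<mu> N * measure M (surv (cyl_at N x) s)
        \<le> measure M (surv (cyl_at N x) s) - measure M (surv (cyl_at N x) (Suc s)) \<and>
      measure M (surv (cyl_at N x) s) - measure M (surv (cyl_at N x) (Suc s))
        \<le> (\<theta> + c) * ?\<mu> N * measure M (surv (cyl_at N x) s)"
      by (rule survivor_loss[OF x \<gamma> decay G cover no_return ratio c])
    ultimately show "\<forall>\<^sub>F N in sequentially. dist (?r N / ?\<mu> N) \<theta> < e"
      using good
    proof eventually_elim
      case (elim N)
      have N: "1 \<le> N" "4 * D * real N * ?\<mu> N \<le> 1" using elim(5) by auto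
      note U = cyl_at_in[OF x, of N]
      have \<mu>0: "0 < ?\<mu> N" by (rule cyl_pos[OF N(1) U])
      note rate_bounds = exponential_rate_bounds[where m = m,
          OF surv_decreases_slowly(1)[OF N(1) U N(2)] elim(2,3) _ _ real_rate[OF N]]
      have b: "(\<theta> - c) * ?\<mu> N \<le> ?r N" "?r N \<le> (\<theta> + c) * ?\<mu> N / (1 - (\<theta> + c) * ?\<mu> N)"
        by (rule rate_bounds; use elim(4) in blast)+
      have "\<theta> - c \<le> ?r N / ?\<mu> N" using b(1) \<mu>0 by (simp add: pos_le_divide_eq)
      moreover have "?r N / ?\<mu> N \<le> (\<theta> + c) / (1 - (\<theta> + c) * ?\<mu> N)"
        using b(2) \<mu>0 by (simp add: pos_divide_le_eq)
      ultimately show ?case using elim(1) c by (simp add: dist_real_def c_def abs_less_iff)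
    qed
  qed
  then have "(\<lambda>N. ereal (?r N / ?\<mu> N)) \<longlonglongrightarrow> ereal \<theta>" by simp
  moreover have "\<forall>\<^sub>F N in sequentially. ereal (?r N / ?\<mu> N) = escape_rate M T (cyl_at N x) / ereal (?\<mu> N)"
    using good
  proof eventually_elim
    case (elim N)
    then have N: "1 \<le> N" "4 * D * real N * ?\<mu> N \<le> 1" by auto
    have "escape_rate M T (cyl_at N x) = ereal (?r N)"
      unfolding escape_rate_def by (rule limI[OF rate[OF N]])
    moreover have "?\<mu> N \<noteq> 0" using cyl_pos[OF N(1) cyl_at_in[OF x]] by simp
    ultimately show ?case by simp
  qed
  ultimately have "(\<lambda>N. escape_rate M T (cyl_at N x) / ereal (?\<mu> N)) \<longlonglongrightarrow> ereal \<theta>"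
    by (rule Lim_transform_eventually)
  moreover have "\<forall>\<^sub>F N in sequentially. has_escape_rate M T (cyl_at N x)"
    using good by eventually_elim (auto simp: has_escape_rate_def intro!: convergentI rate)
  ultimately show ?thesis by (simp add: has_local_escape_rate_def)
qed

section \<open>Atoms\<close>

text \<open>
  By ergodicity an atom \<open>y\<close> returns to itself, so its orbit is finite, and this orbit visits every
  cylinder of \<open>x\<close>. As the cylinders shrink to \<open>x\<close>, the point \<open>x\<close> belongs to the orbit.
\<close>

lemma atom_forces_periodic_atom:
  assumes y: "y \<in> space M" "0 < measure M {y}" and x: "x \<in> space M"
  shows "periodic_point T x" and "0 < measure M {x}"
proof -
  obtain q where q: "1 \<le> q" "0 < measure M ({y} \<inter> pre q {y})"
    using ergodic_connects[OF singleton_sets[OF y(1)] y(2) singleton_sets[OF y(1)] y(2)] by blast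
  then have "{y} \<inter> pre q {y} \<noteq> {}" by (intro notI) simp
  then have per: "(T ^^ q) y = y" by auto
  have reach: "\<exists>k<q. (T ^^ k) y \<in> cyl_at n x" for n
  proof -
    have "0 < measure M (cyl_at (Suc n) x)" by (rule cyl_pos[OF _ cyl_at_in[OF x]]) simp
    then obtain k where "0 < measure M ({y} \<inter> pre k (cyl_at (Suc n) x))"
      using ergodic_connects[OF singleton_sets[OF y(1)] y(2) cyl_at_sets[OF x]] by blast
    then have "{y} \<inter> pre k (cyl_at (Suc n) x) \<noteq> {}" by (intro notI) simp
    then have "(T ^^ k) y \<in> cyl_at n x" using cyl_at_antimono[OF x, of n "Suc n"] by auto
    then have "(T ^^ (k mod q)) y \<in> cyl_at n x" by (simp add: funpow_mod_eq[OF per])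
    then show ?thesis using q(1) by (intro exI[of _ "k mod q"]) simp
  qed
  have "\<exists>k<q. (T ^^ k) y = x"
  proof (rule ccontr)
    assume "\<not> ?thesis"
    then have "\<forall>k<q. \<exists>n. (T ^^ k) y \<notin> cyl_at n x"
      using Inter_cyl_at[OF x] by blast
    then obtain f where f: "\<And>k. k < q \<Longrightarrow> (T ^^ k) y \<notin> cyl_at (f k) x" by metis
    obtain k where k: "k < q" "(T ^^ k) y \<in> cyl_at (Max (f ` {..<q})) x" using reach by blast
    then have "f k \<le> Max (f ` {..<q})" by (intro Max_ge) auto
    with k f[OF k(1)] cyl_at_antimono[OF x] show False by blast
  qed
  then obtain k where k: "(T ^^ k) y = x" by blast
  have "(T ^^ q) x = (T ^^ k) ((T ^^ q) y)"
    unfolding k[symmetric] by (metis add.commute comp_apply funpow_add)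
  then have "(T ^^ q) x = x" by (simp add: per k)
  then show "periodic_point T x" using q(1) by (auto simp: periodic_point_def)
  have "measure M {y} \<le> measure M (pre k {x})"
    using k y(1) by (intro finite_measure_mono pre_sets singleton_sets x) auto
  with y(2) show "0 < measure M {x}" by (simp add: measure_pre[OF singleton_sets[OF x]])
qed

section \<open>Nonperiodic and periodic points\<close>

text \<open>
  A point of a small cylinder of \<open>x\<close> shadows \<open>x\<close>, so at time \<open>j\<close> it is in a cylinder of \<open>T\<^sup>jx\<close>,
  which is disjoint from that of \<open>x\<close> once the order is large enough to separate the two points.
\<close>

lemma eventually_no_return:
  assumes x: "x \<in> space M" and j: "(T ^^ j) x \<noteq> x"
  shows "\<forall>\<^sub>F N in sequentially. cyl_at N x \<inter> pre j (cyl_at N x) = {}"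
proof -
  have Tx: "(T ^^ j) x \<in> space M" by (rule funpow_in_space[OF x])
  obtain k where k: "(T ^^ j) x \<notin> cyl_at k x" using Inter_cyl_at[OF x] j by blast
  show ?thesis
    using eventually_ge_at_top[of "j + k"]
  proof eventually_elim
    case (elim N)
    show ?case
    proof (rule ccontr)
      assume "cyl_at N x \<inter> pre j (cyl_at N x) \<noteq> {}"
      then obtain z where z: "z \<in> cyl_at N x" "(T ^^ j) z \<in> cyl_at N x" by blast
      have "z \<in> cyl_at (j + k) x" using z(1) cyl_at_antimono[OF x elim] by blast
      then have "(T ^^ j) z \<in> cyl_at k ((T ^^ j) x)" by (simp add: cyl_at_add[OF x])
      moreover have "(T ^^ j) z \<in> cyl_at k x" using z(2) cyl_at_antimono[OF x, of k N] elim by auto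
      ultimately have "cyl_at k ((T ^^ j) x) = cyl_at k x"
        using cyl_disjoint[OF cyl_at_in[OF Tx] cyl_at_in[OF x]] by blast
      with in_cyl_at[OF Tx, of k] k show False by simp
    qed
  qed
qed

lemma escape_rate_nonperiodic:
  assumes x: "x \<in> space M" and nonper: "\<not> periodic_point T x"
  shows "has_local_escape_rate M T (\<lambda>n. cyl_at n x) 1"
proof (rule local_escape_rate[OF x, of 0 "\<lambda>N. cyl_at N x"])
  show "measure M {z} = 0" if "z \<in> space M" for z
    using atom_forces_periodic_atom(1)[OF that _ x] nonper by (auto simp: zero_less_measure_iff)
  show "saturated (N + 0) (cyl_at N x)" for N using saturated_cyl[OF cyl_at_in[OF x]] by simp
  show "\<forall>\<^sub>F N in sequentially. cyl_at N x \<inter> pre j (cyl_at N x) = {}" if "1 \<le> j" for j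
    using nonper that by (intro eventually_no_return[OF x]) (auto simp: periodic_point_def)
  have "\<forall>\<^sub>F N in sequentially. 1 = measure M (cyl_at N x) / measure M (cyl_at N x)"
    using eventually_ge_at_top[of 1]
    by eventually_elim (use cyl_pos[OF _ cyl_at_in[OF x]] in force)
  then show "(\<lambda>N. measure M (cyl_at N x) / measure M (cyl_at N x)) \<longlonglongrightarrow> 1"
    by (rule Lim_transform_eventually[OF tendsto_const])
qed auto

lemma jac_periodic:
  assumes "(T ^^ m) x = x"
  shows "jac (q * m) x = jac m x ^ q"
proof (induction q)
  case (Suc q)
  have "(T ^^ (q * m)) x = x" using assms by (induction q) (auto simp: funpow_add)
  have "jac (m + k) x = jac m x * jac k ((T ^^ m) x)" for k
    by (induction k) (auto simp: jac_Suc funpow_add add.commute cocycle_prod_def mult.assoc)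
  from this[of "q * m"] show ?case using Suc assms by simp
qed (simp add: cocycle_prod_def)

text \<open>
  The points of the \<open>N\<close>-cylinder of \<open>x\<close> that return to it at time \<open>m\<close> form the \<open>(N + m)\<close>-cylinder of
  \<open>x\<close>, and returns at other multiples of \<open>m\<close> also start there when \<open>N\<close> is large. By distortion, the
  ratio of the measures of these two cylinders tends to \<open>g\<^sub>m(x)\<close>.
\<close>

lemma escape_rate_periodic:
  assumes x: "x \<in> space M" and m: "1 \<le> m" "(T ^^ m) x = x"
    and minimal: "\<And>j. 1 \<le> j \<Longrightarrow> (T ^^ j) x = x \<Longrightarrow> m \<le> j" and contracting: "jac m x < 1"
  shows "has_local_escape_rate M T (\<lambda>n. cyl_at n x) (1 - jac m x)"
proof (rule local_escape_rate[OF x, of m "\<lambda>N. cyl_at N x - cyl_at (N + m) x"])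
  have j0: "0 < jac m x" by (rule jac_pos[OF x])
  have add: "cyl_at (j + N) x = cyl_at j x \<inter> pre j (cyl_at N x)" if "(T ^^ j) x = x" for j N
    using cyl_at_add[OF x, of j N] that by simp
  show "measure M {z} = 0" if z: "z \<in> space M" for z
  proof (rule ccontr)
    assume "measure M {z} \<noteq> 0"
    then have "0 < measure M {z}" by (simp add: zero_less_measure_iff)
    from atom_forces_periodic_atom(2)[OF z this x] have pos: "0 < measure M {x}" .
    have "measure M {x} \<le> D * jac m x ^ Suc q" for q
    proof -
      have 1: "1 \<le> Suc q * m" using m(1) by simp
      have "measure M {x} \<le> measure M (cyl_at (Suc q * m) x)"
        using in_cyl_at[OF x] by (intro finite_measure_mono cyl_at_sets[OF x]) auto
      also have "\<dots> \<le> D * jac (Suc q * m) x"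
        by (rule jac_ge[OF 1 cyl_at_in[OF x] in_cyl_at[OF x]])
      finally show ?thesis by (simp only: jac_periodic[OF m(2)])
    qed
    moreover have "(\<lambda>q. D * jac m x ^ Suc q) \<longlonglongrightarrow> D * 0"
      using j0 contracting by (intro tendsto_mult tendsto_const LIMSEQ_Suc[OF LIMSEQ_power_zero]) auto
    ultimately have "measure M {x} \<le> D * 0" by (intro LIMSEQ_le_const) auto
    with pos show False by simp
  qed
  show "saturated (N + m) (cyl_at N x - cyl_at (N + m) x)" for N
  proof (rule saturated_Diff)
    show "saturated (N + m) (cyl_at N x)"
      by (rule saturated_mono[OF saturated_cyl[OF cyl_at_in[OF x]]]) simp
  qed (rule saturated_cyl[OF cyl_at_in[OF x]])
  show "\<forall>\<^sub>F N in sequentially. cyl_at N x - (cyl_at N x - cyl_at (N + m) x) \<subseteq> (\<Union>j\<in>{1..m}. pre j (cyl_at N x))"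
    using add[OF m(2)] m(1) by (intro always_eventually) (auto simp: add.commute[of _ m])
  show "\<forall>\<^sub>F N in sequentially. (cyl_at N x - cyl_at (N + m) x) \<inter> pre j (cyl_at N x) = {}" if j: "1 \<le> j" for j
  proof (cases "(T ^^ j) x = x")
    case False
    from eventually_no_return[OF x this] show ?thesis by eventually_elim blast
  next
    case True
    show ?thesis
      using eventually_ge_at_top[of j]
    proof eventually_elim
      case (elim N)
      have "cyl_at N x \<inter> pre j (cyl_at N x) \<subseteq> cyl_at (j + N) x"
        using add[OF True, of N] cyl_at_antimono[OF x elim] by blast
      also have "\<dots> \<subseteq> cyl_at (N + m) x"
        using minimal[OF j True] by (intro cyl_at_antimono x) simp
      finally show ?case by blast
    qed
  qed
  have U: "cyl_at N x \<in> cyl N" for N by (rule cyl_at_in[OF x])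
  define \<kappa> where "\<kappa> N = 1 + D * lam ^ N" for N
  have \<kappa>: "1 \<le> \<kappa> N" for N using D lam by (simp add: \<kappa>_def)
  have "(\<lambda>N. 1 + D * lam ^ N) \<longlonglongrightarrow> 1 + D * 0"
    using lam by (intro tendsto_add tendsto_mult tendsto_const LIMSEQ_power_zero) auto
  then have \<kappa>_lim: "\<kappa> \<longlonglongrightarrow> 1" by (simp add: \<kappa>_def[abs_def])
  have bounds: "measure M (cyl_at (N + m) x) \<le> (\<kappa> N * jac m x) * measure M (cyl_at N x)"
    "(jac m x / \<kappa> N) * measure M (cyl_at N x) \<le> measure M (cyl_at (N + m) x)" if N: "1 \<le> N" for N
  proof -
    have eq: "cyl_at (N + m) x = cyl_at m x \<inter> pre m (cyl_at N x)"
      using add[OF m(2), of N] by (simp add: add.commute)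
    have xin: "x \<in> cyl_at m x \<inter> pre m (cyl_at N x)" using in_cyl_at[OF x, of "N + m"] eq by simp
    have img: "cyl_at N x \<subseteq> (T ^^ m) ` cyl_at m x"
      using xin by (intro image_contains_cyl[OF U N U]) blast
    have r: "jac m z \<le> \<kappa> N * jac m x" "jac m x \<le> \<kappa> N * jac m z" if "z \<in> cyl_at m x \<inter> pre m (cyl_at N x)" for z
      unfolding \<kappa>_def using jac_ratio[OF m(1) U N U] that xin by blast+
    show "measure M (cyl_at (N + m) x) \<le> (\<kappa> N * jac m x) * measure M (cyl_at N x)"
      unfolding eq using r(1) j0 \<kappa>[of N] by (intro measure_cyl_pre_le[OF U cyl_sets[OF U]]) auto
    show "(jac m x / \<kappa> N) * measure M (cyl_at N x) \<le> measure M (cyl_at (N + m) x)"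
      unfolding eq
    proof (rule measure_cyl_pre_ge[OF U cyl_sets[OF U] img])
      show "jac m x / \<kappa> N \<le> jac m z" if "z \<in> cyl_at m x \<inter> pre m (cyl_at N x)" for z
        using r(2)[OF that] \<kappa>[of N] by (simp add: pos_divide_le_eq mult.commute)
    qed
  qed
  have "(\<lambda>N. measure M (cyl_at (N + m) x) / measure M (cyl_at N x)) \<longlonglongrightarrow> jac m x"
  proof (rule tendsto_sandwich[of "\<lambda>N. jac m x / \<kappa> N" _ _ "\<lambda>N. \<kappa> N * jac m x"])
    have "(\<lambda>N. jac m x / \<kappa> N) \<longlonglongrightarrow> jac m x / 1" by (intro tendsto_divide tendsto_const \<kappa>_lim) simp
    then show "(\<lambda>N. jac m x / \<kappa> N) \<longlonglongrightarrow> jac m x" by simp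
    have "(\<lambda>N. \<kappa> N * jac m x) \<longlonglongrightarrow> 1 * jac m x" by (intro tendsto_mult tendsto_const \<kappa>_lim)
    then show "(\<lambda>N. \<kappa> N * jac m x) \<longlonglongrightarrow> jac m x" by simp
    show "\<forall>\<^sub>F N in sequentially. jac m x / \<kappa> N \<le> measure M (cyl_at (N + m) x) / measure M (cyl_at N x)"
      using eventually_ge_at_top[of 1]
      by eventually_elim (use bounds(2) cyl_pos[OF _ U] in \<open>simp add: pos_le_divide_eq\<close>)
    show "\<forall>\<^sub>F N in sequentially. measure M (cyl_at (N + m) x) / measure M (cyl_at N x) \<le> \<kappa> N * jac m x"
      using eventually_ge_at_top[of 1]
      by eventually_elim (use bounds(1) cyl_pos[OF _ U] in \<open>simp add: pos_divide_le_eq\<close>)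
  qed
  then have "(\<lambda>N. 1 - measure M (cyl_at (N + m) x) / measure M (cyl_at N x)) \<longlonglongrightarrow> 1 - jac m x"
    by (intro tendsto_diff tendsto_const)
  moreover have "\<forall>\<^sub>F N in sequentially. 1 - measure M (cyl_at (N + m) x) / measure M (cyl_at N x)
      = measure M (cyl_at N x - cyl_at (N + m) x) / measure M (cyl_at N x)"
    using eventually_ge_at_top[of 1]
  proof eventually_elim
    case (elim N)
    have "measure M (cyl_at N x - cyl_at (N + m) x) = measure M (cyl_at N x) - measure M (cyl_at (N + m) x)"
      by (intro finite_measure_Diff cyl_at_sets x cyl_at_antimono) simp
    with cyl_pos[OF elim U] show ?case by (simp add: diff_divide_distrib)
  qed
  ultimately show "(\<lambda>N. measure M (cyl_at N x - cyl_at (N + m) x) / measure M (cyl_at N x)) \<longlonglongrightarrow> 1 - jac m x"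
    by (rule Lim_transform_eventually)
qed auto

end

section \<open>Local escape rates of Gibbs-Markov maps\<close>

lemma gibbs_markov_obtains_constant:
  assumes "lebesgue_probability_space M" "0 < lam" "lam < 1" "gibbs_markov lam M T P g" "ergodic M T"
  obtains D where "ergodic_gibbs_markov M T P g lam D"
proof -
  interpret prob_space M using assms(1) by (simp add: lebesgue_probability_space_def)
  have "bounded_distortion lam M T P g" using assms(4) by (simp add: gibbs_markov_def)
  then obtain D where D: "1 < D"
    "\<forall>n \<ge> 1. \<forall>C \<in> cylinders M T P n. \<forall>y \<in> C. \<forall>z \<in> C.
       \<bar>cocycle_prod T g n y / cocycle_prod T g n z - 1\<bar> \<le> D * cylinder_dist lam M T P ((T ^^ n) y) ((T ^^ n) z)"
    "\<forall>n \<ge> 1. \<forall>z \<in> space M. 1 / D \<le> measure M (cylinder_of M T P n z) / cocycle_prod T g n z \<and>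
       measure M (cylinder_of M T P n z) / cocycle_prod T g n z \<le> D"
    unfolding bounded_distortion_def by (elim conjE exE) (rule that)
  have "ergodic_gibbs_markov M T P g lam D"
    by unfold_locales (use assms D in \<open>auto simp: gibbs_markov_def\<close>)
  then show ?thesis by (rule that)
qed

theorem theorem6:
  fixes M :: "'a measure" and T :: "'a \<Rightarrow> 'a" and P :: "'a set set"
    and g :: "'a \<Rightarrow> real" and lam :: real and x :: 'a
  assumes "lebesgue_probability_space M"
    and "0 < lam" and "lam < 1"
    and "gibbs_markov lam M T P g"
    and "ergodic M T"
    and "x \<in> space M"
  shows "(\<not> periodic_point T x \<longrightarrow>
            has_local_escape_rate M T (\<lambda>n. cylinder_of M T P n x) 1) \<and>
         (\<forall>m. periodic_point T x \<and> m = minimal_period T x \<and> cocycle_prod T g m x < 1 / 2 \<longrightarrow>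
            has_local_escape_rate M T (\<lambda>n. cylinder_of M T P n x) (1 - cocycle_prod T g m x))"
proof -
  obtain D where "ergodic_gibbs_markov M T P g lam D"
    by (rule gibbs_markov_obtains_constant[OF assms(1-5)])
  then interpret ergodic_gibbs_markov M T P g lam D .
  show ?thesis
  proof (intro conjI impI allI)
    assume "\<not> periodic_point T x"
    with assms(6) show "has_local_escape_rate M T (\<lambda>n. cylinder_of M T P n x) 1"
      by (rule escape_rate_nonperiodic)
  next
    fix m assume m: "periodic_point T x \<and> m = minimal_period T x \<and> cocycle_prod T g m x < 1 / 2"
    then have "1 \<le> m \<and> (T ^^ m) x = x"
      unfolding periodic_point_def minimal_period_def
      using LeastI_ex[of "\<lambda>m. 1 \<le> m \<and> (T ^^ m) x = x"] by blast
    moreover have "m \<le> j" if "1 \<le> j" "(T ^^ j) x = x" for j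
      using m that by (auto simp: minimal_period_def intro: Least_le)
    ultimately show "has_local_escape_rate M T (\<lambda>n. cylinder_of M T P n x) (1 - cocycle_prod T g m x)"
      using m by (intro escape_rate_periodic assms(6)) auto
  qed
qed

end
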